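(* Let $(X,d)$ be a metric space and let $\mathcal{B}$ be a bornology on $X$ with a closed base such that $\mathcal{B}\subseteq\mathcal{K}$. Then $(C(X),\tau_{\mathcal{B}})^*$, equipped with the topology $\tau_{ucb}$, is isomorphic (as a topological vector space) to $(\mathscr{M}_{\mathcal{B}}(X),\sigma)$.
   Context: $C(X)$ is the real vector space of continuous functions $X\to\mathbb{R}$. A bornology $\mathcal{B}$ on $X$ is a collection of non-empty subsets of $X$ that covers $X$ and is closed under finite unions and under taking (non-empty) subsets of its members; it has a closed base if every member of $\mathcal{B}$ is contained in a closed member of $\mathcal{B}$. $\mathcal{K}$ is the bornology of all non-empty relatively compact subsets of $X$. For $B\in\mathcal{B}$ let $\rho_B(f)=\sup_{x\in B}|f(x)|$ (finite when $B\in\mathcal{K}$). $\tau_{\mathcal{B}}$ is the locally convex topology on $C(X)$ for which the sets $\rho_B^{-1}([0,r))$ ($B\in\mathcal{B}$, $r>0$) form a neighborhood base at $0$. $(C(X),\tau_{\mathcal{B}})^*$ is the space of all continuous linear functionals into $\mathbb{R}$. A set $\mathbb{B}\subseteq C(X)$ is bounded in the locally convex space $(C(X),\tau_{\mathcal{B}})$ if it is absorbed by every neighborhood of $0$. $\tau_{ucb}$ is the locally convex topology on $(C(X),\tau_{\mathcal{B}})^*$ induced by the seminorms $F\mapsto\sup_{f\in\mathbb{B}}|F(f)|$, $\mathbb{B}$ ranging over the bounded subsets of $(C(X),\tau_{\mathcal{B}})$. $\mathscr{M}_{\mathcal{B}}(X)$ is the vector space of all closed regular, finite (signed) Borel measures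 $\mu$ on $X$ for which there is a closed $B\in\mathcal{B}$ with $|\mu|(X\setminus B)=0$; closed regular means that for every Borel set $A$ and $\epsilon>0$ there are a closed $C$ and an open $U$ with $C\subseteq A\subseteq U$ and $|\mu|(U\setminus C)<\epsilon$. For $\mathcal{B}\subseteq\mathcal{K}$, $\sigma$ is the locally convex topology on $\mathscr{M}_{\mathcal{B}}(X)$ induced by the seminorms $\omega_{\mathbb{B}}(\mu)=\sup_{f\in\mathbb{B}}\left|\int_X f\,d\mu\right|$, where $\mathbb{B}$ ranges over the bounded subsets of $(C(X),\tau_{\mathcal{B}})$. *)

theory Defs
  imports "HOL-Analysis.Analysis"
begin

text \<open>
  All vector spaces below are linear subspaces \<open>V\<close> of a space \<open>'i \<Rightarrow> real\<close> of real functions with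
  pointwise operations: \<open>'i\<close> is the underlying metric space for \<open>C(X)\<close>, the type of real functions
  on it for the dual, and the type of its subsets for spaces of signed measures.
\<close>

section \<open>Vector topologies given by neighborhoods of zero\<close>

text \<open>The translation invariant topology on \<open>V\<close> for which the sets in \<open>N\<close>, intersected with \<open>V\<close>,
  are a neighborhood base at zero.\<close>

definition zero_base_topology ::
    "('i \<Rightarrow> real) set \<Rightarrow> ('i \<Rightarrow> real) set set \<Rightarrow> ('i \<Rightarrow> real) topology" where
  "zero_base_topology V N = topology (\<lambda>U. U \<subseteq> V \<and>
     (\<forall>u\<in>U. \<exists>W\<in>N. {v \<in> V. (\<lambda>i. v i - u i) \<in> W} \<subseteq> U))"

text \<open>Seminorms take values in \<open>ennreal\<close>, so that a supremum is a genuine one whether or not it is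
  known to be finite.\<close>

definition seminorm_topology ::
    "('i \<Rightarrow> real) set \<Rightarrow> (('i \<Rightarrow> real) \<Rightarrow> ennreal) set \<Rightarrow> ('i \<Rightarrow> real) topology" where
  "seminorm_topology V P = zero_base_topology V
     {{v. \<forall>p\<in>Q. p v < ennreal r} |Q r. finite Q \<and> Q \<subseteq> P \<and> 0 < r}"

definition absorbs :: "('i \<Rightarrow> real) set \<Rightarrow> ('i \<Rightarrow> real) set \<Rightarrow> bool" where
  "absorbs U A \<longleftrightarrow> (\<exists>s>0. \<forall>t>s. A \<subseteq> (\<lambda>f i. t * f i) ` U)"

definition vbounded :: "('i \<Rightarrow> real) topology \<Rightarrow> ('i \<Rightarrow> real) set \<Rightarrow> bool" where
  "vbounded T A \<longleftrightarrow> A \<subseteq> topspace T \<and> (\<forall>U. openin T U \<and> (\<lambda>i. 0) \<in> U \<longrightarrow> absorbs U A)"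

definition tvs_isomorphism ::
    "('i \<Rightarrow> real) topology \<Rightarrow> ('j \<Rightarrow> real) topology \<Rightarrow> (('i \<Rightarrow> real) \<Rightarrow> ('j \<Rightarrow> real)) \<Rightarrow> bool" where
  "tvs_isomorphism S T \<Phi> \<longleftrightarrow> homeomorphic_map S T \<Phi> \<and>
     (\<forall>u\<in>topspace S. \<forall>v\<in>topspace S. \<Phi> (\<lambda>i. u i + v i) = (\<lambda>j. \<Phi> u j + \<Phi> v j)) \<and>
     (\<forall>c. \<forall>u\<in>topspace S. \<Phi> (\<lambda>i. c * u i) = (\<lambda>j. c * \<Phi> u j))"

definition tvs_isomorphic :: "('i \<Rightarrow> real) topology \<Rightarrow> ('j \<Rightarrow> real) topology \<Rightarrow> bool" where
  "tvs_isomorphic S T \<longleftrightarrow> (\<exists>\<Phi>. tvs_isomorphism S T \<Phi>)"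

lemma istopology_zero_base:
  assumes "N \<noteq> {}"
    and dir: "\<And>W W'. W \<in> N \<Longrightarrow> W' \<in> N \<Longrightarrow> \<exists>W''\<in>N. W'' \<subseteq> W \<inter> W'"
  shows "istopology (\<lambda>U. U \<subseteq> V \<and> (\<forall>u\<in>U. \<exists>W\<in>N. {v \<in> V. (\<lambda>i. v i - u i) \<in> W} \<subseteq> U))"
    (is "istopology ?P")
  unfolding istopology_def
proof (intro conjI allI impI)
  fix S T assume S: "?P S" and T: "?P T"
  show "S \<inter> T \<subseteq> V" using S by blast
  show "\<forall>u\<in>S \<inter> T. \<exists>W\<in>N. {v \<in> V. (\<lambda>i. v i - u i) \<in> W} \<subseteq> S \<inter> T"
  proof
    fix u assume u: "u \<in> S \<inter> T"
    obtain W where W: "W \<in> N" "{v \<in> V. (\<lambda>i. v i - u i) \<in> W} \<subseteq> S" using S u by blast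
    obtain W' where W': "W' \<in> N" "{v \<in> V. (\<lambda>i. v i - u i) \<in> W'} \<subseteq> T" using T u by blast
    obtain W'' where "W'' \<in> N" "W'' \<subseteq> W \<inter> W'" using dir W(1) W'(1) by blast
    then show "\<exists>W\<in>N. {v \<in> V. (\<lambda>i. v i - u i) \<in> W} \<subseteq> S \<inter> T"
      using W W' by (intro bexI[of _ W'']) blast+
  qed
next
  fix K assume K: "\<forall>S\<in>K. ?P S"
  show "\<Union>K \<subseteq> V" using K by blast
  show "\<forall>u\<in>\<Union>K. \<exists>W\<in>N. {v \<in> V. (\<lambda>i. v i - u i) \<in> W} \<subseteq> \<Union>K"
  proof
    fix u assume "u \<in> \<Union>K"
    then obtain S where S: "S \<in> K" "u \<in> S" by blast
    then obtain W where "W \<in> N" "{v \<in> V. (\<lambda>i. v i - u i) \<in> W} \<subseteq> S" using K by blast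
    then show "\<exists>W\<in>N. {v \<in> V. (\<lambda>i. v i - u i) \<in> W} \<subseteq> \<Union>K"
      using S(1) by (intro bexI[of _ W]) blast+
  qed
qed

lemma openin_zero_base:
  assumes "N \<noteq> {}"
    and "\<And>W W'. W \<in> N \<Longrightarrow> W' \<in> N \<Longrightarrow> \<exists>W''\<in>N. W'' \<subseteq> W \<inter> W'"
  shows "openin (zero_base_topology V N) U \<longleftrightarrow>
    U \<subseteq> V \<and> (\<forall>u\<in>U. \<exists>W\<in>N. {v \<in> V. (\<lambda>i. v i - u i) \<in> W} \<subseteq> U)"
  unfolding zero_base_topology_def
  by (subst topology_inverse') (intro istopology_zero_base assms, assumption+, rule refl)

lemma topspace_zero_base:
  assumes "N \<noteq> {}"
    and "\<And>W W'. W \<in> N \<Longrightarrow> W' \<in> N \<Longrightarrow> \<exists>W''\<in>N. W'' \<subseteq> W \<inter> W'"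
  shows "topspace (zero_base_topology V N) = V"
proof
  show "topspace (zero_base_topology V N) \<subseteq> V"
    using openin_zero_base[OF assms, of V] openin_topspace by blast
  have "openin (zero_base_topology V N) V"
    using assms(1) by (subst openin_zero_base[OF assms]) auto
  then show "V \<subseteq> topspace (zero_base_topology V N)" by (rule openin_subset)
qed

lemma seminorm_base_directed:
  fixes P :: "(('i \<Rightarrow> real) \<Rightarrow> ennreal) set"
  defines "N \<equiv> {{v. \<forall>p\<in>Q. p v < ennreal r} |Q r. finite Q \<and> Q \<subseteq> P \<and> 0 < r}"
  shows "N \<noteq> {}" and "W \<in> N \<Longrightarrow> W' \<in> N \<Longrightarrow> \<exists>W''\<in>N. W'' \<subseteq> W \<inter> W'"
proof -
  have "{v. \<forall>p\<in>{}. p v < ennreal 1} \<in> N"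
    unfolding N_def mem_Collect_eq by (intro exI[of _ "{}"] exI[of _ 1]) simp
  then show "N \<noteq> {}" by blast
next
  assume "W \<in> N" "W' \<in> N"
  then obtain Q r Q' r' where
    W: "W = {v. \<forall>p\<in>Q. p v < ennreal r}" "finite Q" "Q \<subseteq> P" "0 < r" and
    W': "W' = {v. \<forall>p\<in>Q'. p v < ennreal r'}" "finite Q'" "Q' \<subseteq> P" "0 < r'"
    unfolding N_def by blast
  let ?W = "{v. \<forall>p\<in>Q \<union> Q'. p v < ennreal (min r r')}"
  have "ennreal (min r r') \<le> ennreal r" "ennreal (min r r') \<le> ennreal r'"
    by (auto intro: ennreal_leI)
  then have "?W \<subseteq> W \<inter> W'"
    unfolding W W' by (auto dest: less_le_trans)
  moreover have "?W \<in> N"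
    unfolding N_def mem_Collect_eq using W W'
    by (intro exI[of _ "Q \<union> Q'"] exI[of _ "min r r'"]) auto
  ultimately show "\<exists>W''\<in>N. W'' \<subseteq> W \<inter> W'" by blast
qed

lemma topspace_seminorm_topology [simp]: "topspace (seminorm_topology V P) = V"
  unfolding seminorm_topology_def
  by (rule topspace_zero_base[OF seminorm_base_directed])

lemma bex_setcompr2: "(\<exists>W\<in>{F a b |a b. R a b}. T W) \<longleftrightarrow> (\<exists>a b. R a b \<and> T (F a b))"
  by blast

lemma openin_seminorm_topology:
  "openin (seminorm_topology V P) U \<longleftrightarrow> U \<subseteq> V \<and>
     (\<forall>u\<in>U. \<exists>Q r. finite Q \<and> Q \<subseteq> P \<and> 0 < r \<and>
        {v \<in> V. \<forall>p\<in>Q. p (\<lambda>i. v i - u i) < ennreal r} \<subseteq> U)"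
proof -
  have "(\<exists>W\<in>{{v. \<forall>p\<in>Q. p v < ennreal r} |Q r. finite Q \<and> Q \<subseteq> P \<and> 0 < r}. 
          {v \<in> V. (\<lambda>i. v i - u i) \<in> W} \<subseteq> U) \<longleftrightarrow>
        (\<exists>Q r. finite Q \<and> Q \<subseteq> P \<and> 0 < r \<and>
          {v \<in> V. \<forall>p\<in>Q. p (\<lambda>i. v i - u i) < ennreal r} \<subseteq> U)" for u
    unfolding bex_setcompr2 mem_Collect_eq conj_assoc ..
  moreover have "openin (seminorm_topology V P) U \<longleftrightarrow> U \<subseteq> V \<and>
      (\<forall>u\<in>U. \<exists>W\<in>{{v. \<forall>p\<in>Q. p v < ennreal r} |Q r. finite Q \<and> Q \<subseteq> P \<and> 0 < r}.
          {v \<in> V. (\<lambda>i. v i - u i) \<in> W} \<subseteq> U)"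
    unfolding seminorm_topology_def by (intro openin_zero_base seminorm_base_directed)
  ultimately show ?thesis by (simp only:)
qed


section \<open>Bornologies and the function space\<close>

definition bornology :: "'a set set \<Rightarrow> bool" where
  "bornology \<B> \<longleftrightarrow> (\<forall>B\<in>\<B>. B \<noteq> {}) \<and> \<Union>\<B> = UNIV \<and>
     (\<forall>A\<in>\<B>. \<forall>B\<in>\<B>. A \<union> B \<in> \<B>) \<and>
     (\<forall>B\<in>\<B>. \<forall>A. A \<subseteq> B \<and> A \<noteq> {} \<longrightarrow> A \<in> \<B>)"

lemma
  assumes "bornology \<B>"
  shows bornology_covers: "\<Union>\<B> = UNIV"
    and bornology_Un: "A \<in> \<B> \<Longrightarrow> B \<in> \<B> \<Longrightarrow> A \<union> B \<in> \<B>"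
proof -
  note * = assms[unfolded bornology_def]
  show "\<Union>\<B> = UNIV" by (rule *[THEN conjunct2, THEN conjunct1])
  show "A \<in> \<B> \<Longrightarrow> B \<in> \<B> \<Longrightarrow> A \<union> B \<in> \<B>"
    by (rule *[THEN conjunct2, THEN conjunct2, THEN conjunct1, rule_format])
qed

definition closed_base :: "'a::topological_space set set \<Rightarrow> bool" where
  "closed_base \<B> \<longleftrightarrow> (\<forall>B\<in>\<B>. \<exists>C\<in>\<B>. closed C \<and> B \<subseteq> C)"

definition relatively_compact_bornology :: "'a::topological_space set set" where
  "relatively_compact_bornology = {A. A \<noteq> {} \<and> compact (closure A)}"

definition cfun_space :: "('a::topological_space \<Rightarrow> real) set" where
  "cfun_space = {f. continuous_on UNIV f}"

definition rho :: "'a set \<Rightarrow> ('a \<Rightarrow> real) \<Rightarrow> ennreal" where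
  "rho B f = (SUP x\<in>B. ennreal \<bar>f x\<bar>)"

definition tau :: "'a::topological_space set set \<Rightarrow> ('a \<Rightarrow> real) topology" where
  "tau \<B> = zero_base_topology cfun_space {{f. rho B f < ennreal r} |B r. B \<in> \<B> \<and> 0 < r}"

lemma tau_base_directed:
  assumes "bornology \<B>"
  defines "N \<equiv> {{f. rho B f < ennreal r} |B r. B \<in> \<B> \<and> 0 < r}"
  shows "N \<noteq> {}" and "W \<in> N \<Longrightarrow> W' \<in> N \<Longrightarrow> \<exists>W''\<in>N. W'' \<subseteq> W \<inter> W'"
proof -
  obtain B where "B \<in> \<B>" using bornology_covers[OF assms(1)] by (metis UNIV_I UnionE)
  then have "{f. rho B f < ennreal 1} \<in> N"
    unfolding N_def mem_Collect_eq by (intro exI[of _ B] exI[of _ 1]) simp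
  then show "N \<noteq> {}" by blast
next
  assume "W \<in> N" "W' \<in> N"
  then obtain B r B' r' where
    W: "W = {f. rho B f < ennreal r}" "B \<in> \<B>" "0 < r" and
    W': "W' = {f. rho B' f < ennreal r'}" "B' \<in> \<B>" "0 < r'"
    unfolding N_def mem_Collect_eq by (elim exE conjE)
  let ?W = "{f. rho (B \<union> B') f < ennreal (min r r')}"
  have "ennreal (min r r') \<le> ennreal r" "ennreal (min r r') \<le> ennreal r'"
    by (auto intro: ennreal_leI)
  moreover have "rho B f \<le> rho (B \<union> B') f" "rho B' f \<le> rho (B \<union> B') f" for f
    unfolding rho_def by (auto intro: SUP_subset_mono)
  ultimately have "rho B f < ennreal r \<and> rho B' f < ennreal r'"
    if "rho (B \<union> B') f < ennreal (min r r')" for f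
    using le_less_trans[OF _ less_le_trans[OF that]] by simp
  then have "?W \<subseteq> W \<inter> W'" unfolding W(1) W'(1) by (simp add: subset_eq)
  moreover have "B \<union> B' \<in> \<B>" by (rule bornology_Un[OF assms(1) W(2) W'(2)])
  then have "?W \<in> N"
    unfolding N_def mem_Collect_eq using W W'
    by (intro exI[of _ "B \<union> B'"] exI[of _ "min r r'"]) simp
  ultimately show "\<exists>W''\<in>N. W'' \<subseteq> W \<inter> W'" by blast
qed

lemma topspace_tau: "bornology \<B> \<Longrightarrow> topspace (tau \<B>) = cfun_space"
  unfolding tau_def by (rule topspace_zero_base[OF tau_base_directed])

lemma openin_tau:
  assumes "bornology \<B>"
  shows "openin (tau \<B>) U \<longleftrightarrow> U \<subseteq> cfun_space \<and>
    (\<forall>u\<in>U. \<exists>B\<in>\<B>. \<exists>r>0. {f \<in> cfun_space. rho B (\<lambda>x. f x - u x) < ennreal r} \<subseteq> U)"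
proof -
  have "(\<exists>W\<in>{{f. rho B f < ennreal r} |B r. B \<in> \<B> \<and> 0 < r}.
          {v \<in> cfun_space. (\<lambda>i. v i - u i) \<in> W} \<subseteq> U) \<longleftrightarrow>
        (\<exists>B\<in>\<B>. \<exists>r>0. {f \<in> cfun_space. rho B (\<lambda>x. f x - u x) < ennreal r} \<subseteq> U)" for u
    unfolding bex_setcompr2 mem_Collect_eq by blast
  moreover have "openin (tau \<B>) U \<longleftrightarrow> U \<subseteq> cfun_space \<and>
      (\<forall>u\<in>U. \<exists>W\<in>{{f. rho B f < ennreal r} |B r. B \<in> \<B> \<and> 0 < r}.
          {v \<in> cfun_space. (\<lambda>i. v i - u i) \<in> W} \<subseteq> U)"
    unfolding tau_def by (intro openin_zero_base tau_base_directed assms)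
  ultimately show ?thesis by (simp only:)
qed

lemma tau_neighborhood_base:
  assumes "bornology \<B>"
  shows "(\<exists>T. openin (tau \<B>) T \<and> (\<lambda>x. 0) \<in> T \<and> T \<subseteq> U) \<longleftrightarrow>
    (\<exists>B\<in>\<B>. \<exists>r>0. {f \<in> cfun_space. rho B f < ennreal r} \<subseteq> U)"
proof
  assume "\<exists>T. openin (tau \<B>) T \<and> (\<lambda>x. 0) \<in> T \<and> T \<subseteq> U"
  then obtain T where T: "openin (tau \<B>) T" "(\<lambda>x. 0) \<in> T" "T \<subseteq> U" by blast
  from T(1,2) obtain B r where "B \<in> \<B>" "r > 0"
      "{f \<in> cfun_space. rho B (\<lambda>x. f x - 0) < ennreal r} \<subseteq> T"
    by (auto simp only: openin_tau[OF assms])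
  then show "\<exists>B\<in>\<B>. \<exists>r>0. {f \<in> cfun_space. rho B f < ennreal r} \<subseteq> U"
    using T(3) by auto
next
  assume "\<exists>B\<in>\<B>. \<exists>r>0. {f \<in> cfun_space. rho B f < ennreal r} \<subseteq> U"
  then obtain B r where B: "B \<in> \<B>" "r > 0" "{f \<in> cfun_space. rho B f < ennreal r} \<subseteq> U" by blast
  let ?T = "{f \<in> cfun_space. rho B f < ennreal r}"
  have "openin (tau \<B>) ?T"
    unfolding openin_tau[OF assms]
  proof (intro conjI ballI)
    fix u assume u: "u \<in> ?T"
    define a where "a = enn2real (rho B u)"
    have a: "rho B u = ennreal a" "0 \<le> a"
      using u unfolding a_def by (auto simp: ennreal_enn2real_if)
    have ar: "a < r" using u a by (simp add: ennreal_less_iff)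
    have "rho B f < ennreal r"
      if "rho B (\<lambda>x. f x - u x) < ennreal (r - a)" for f
    proof -
      have "rho B f \<le> rho B u + rho B (\<lambda>x. f x - u x)"
        unfolding rho_def
      proof (rule SUP_least)
        fix x assume x: "x \<in> B"
        have "ennreal \<bar>f x\<bar> \<le> ennreal (\<bar>u x\<bar> + \<bar>f x - u x\<bar>)" by (intro ennreal_leI) linarith
        also have "\<dots> = ennreal \<bar>u x\<bar> + ennreal \<bar>f x - u x\<bar>" by (simp add: ennreal_plus)
        also have "\<dots> \<le> (SUP x\<in>B. ennreal \<bar>u x\<bar>) + (SUP x\<in>B. ennreal \<bar>f x - u x\<bar>)"
          by (intro add_mono SUP_upper x)
        finally show "ennreal \<bar>f x\<bar> \<le> \<dots>" .
      qed
      also have "\<dots> < ennreal a + ennreal (r - a)"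
        unfolding a(1) using that by (simp add: ennreal_add_left_cancel_less)
      also have "\<dots> = ennreal r" using a ar by (simp flip: ennreal_plus)
      finally show ?thesis .
    qed
    then show "\<exists>B\<in>\<B>. \<exists>r>0. {f \<in> cfun_space. rho B (\<lambda>x. f x - u x) < ennreal r} \<subseteq> ?T"
      using B(1) ar by (intro bexI[of _ B] exI[of _ "r - a"]) auto
  qed blast
  moreover have "(\<lambda>x. 0) \<in> ?T"
    using B(2) unfolding rho_def cfun_space_def
    by (auto intro!: le_less_trans[OF SUP_least[of _ _ 0]])
  ultimately show "\<exists>T. openin (tau \<B>) T \<and> (\<lambda>x. 0) \<in> T \<and> T \<subseteq> U" using B(3) by blast
qed


section \<open>The dual\<close>

text \<open>Functionals are normalised to vanish off \<open>C(X)\<close>, so that equality of functionals on \<open>C(X)\<close>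
  is equality in HOL.\<close>

definition cdual :: "'a::topological_space set set \<Rightarrow> (('a \<Rightarrow> real) \<Rightarrow> real) set" where
  "cdual \<B> = {F.
     (\<forall>f\<in>cfun_space. \<forall>g\<in>cfun_space. F (\<lambda>x. f x + g x) = F f + F g) \<and>
     (\<forall>c. \<forall>f\<in>cfun_space. F (\<lambda>x. c * f x) = c * F f) \<and>
     (\<forall>f. f \<notin> cfun_space \<longrightarrow> F f = 0) \<and>
     continuous_map (tau \<B>) euclidean F}"

definition tau_ucb :: "'a::topological_space set set \<Rightarrow> (('a \<Rightarrow> real) \<Rightarrow> real) topology" where
  "tau_ucb \<B> = seminorm_topology (cdual \<B>)
     {\<lambda>F. SUP f\<in>\<F>. ennreal \<bar>F f\<bar> |\<F>. vbounded (tau \<B>) \<F>}"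


section \<open>Signed Borel measures\<close>

text \<open>Likewise, signed measures are normalised to vanish on non-Borel sets.\<close>

definition finite_signed_borel :: "('a::topological_space set \<Rightarrow> real) \<Rightarrow> bool" where
  "finite_signed_borel \<mu> \<longleftrightarrow> \<mu> {} = 0 \<and>
     (\<forall>A. range A \<subseteq> sets borel \<and> disjoint_family A \<longrightarrow>
        (\<lambda>n::nat. \<mu> (A n)) sums \<mu> (\<Union>n. A n)) \<and>
     (\<forall>A. A \<notin> sets borel \<longrightarrow> \<mu> A = 0)"

text \<open>Positive variation \<open>\<mu>\<^sup>+(A) = sup {\<mu>(E) | E \<subseteq> A Borel}\<close>. As \<open>ennreal\<close> truncates negative reals
  to 0 and \<open>\<mu>({}) = 0\<close>, the truncation does not affect the supremum. The negative variation
  \<open>\<mu>\<^sup>-\<close> is the positive variation of \<open>-\<mu>\<close>.\<close>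

definition pos_variation :: "('a::topological_space set \<Rightarrow> real) \<Rightarrow> 'a measure" where
  "pos_variation \<mu> = measure_of UNIV (sets borel)
     (\<lambda>A. SUP E\<in>{E \<in> sets borel. E \<subseteq> A}. ennreal (\<mu> E))"

definition neg_variation :: "('a::topological_space set \<Rightarrow> real) \<Rightarrow> 'a measure" where
  "neg_variation \<mu> = pos_variation (\<lambda>A. - \<mu> A)"

definition total_variation :: "('a::topological_space set \<Rightarrow> real) \<Rightarrow> 'a set \<Rightarrow> ennreal" where
  "total_variation \<mu> A = emeasure (pos_variation \<mu>) A + emeasure (neg_variation \<mu>) A"

definition signed_integral ::
    "('a::topological_space set \<Rightarrow> real) \<Rightarrow> ('a \<Rightarrow> real) \<Rightarrow> real" where
  "signed_integral \<mu> f = integral\<^sup>L (pos_variation \<mu>) f - integral\<^sup>L (neg_variation \<mu>) f"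

definition closed_regular :: "('a::topological_space set \<Rightarrow> real) \<Rightarrow> bool" where
  "closed_regular \<mu> \<longleftrightarrow> (\<forall>A\<in>sets borel. \<forall>\<epsilon>>0. \<exists>C U. closed C \<and> open U \<and> C \<subseteq> A \<and> A \<subseteq> U \<and>
     total_variation \<mu> (U - C) < ennreal \<epsilon>)"

definition measure_space_on ::
    "'a::topological_space set set \<Rightarrow> ('a set \<Rightarrow> real) set" where
  "measure_space_on \<B> = {\<mu>. finite_signed_borel \<mu> \<and> closed_regular \<mu> \<and>
     (\<exists>B\<in>\<B>. closed B \<and> total_variation \<mu> (UNIV - B) = 0)}"

definition sigma_topology :: "'a::topological_space set set \<Rightarrow> ('a set \<Rightarrow> real) topology" where
  "sigma_topology \<B> = seminorm_topology (measure_space_on \<B>)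
     {\<lambda>\<mu>. SUP f\<in>\<F>. ennreal \<bar>signed_integral \<mu> f\<bar> |\<F>. vbounded (tau \<B>) \<F>}"

end

theory Submission
  imports Defs
begin

text \<open>The isomorphism is the inverse of the map that sends a measure \<open>\<mu>\<close> to the functional
  \<open>f \<mapsto> \<integral> f d\<mu>\<close>. The two families of seminorms correspond under it: a bounded set \<open>\<F>\<close>
  gives \<open>sup {\<bar>F f\<bar> | f \<in> \<F>}\<close> on one side and the same number for the measure representing \<open>F\<close>
  on the other. Hence it only has to be shown that the map is a linear bijection
  (lemma \<open>tvs_isomorphism_of_seminorms\<close>).

  A closed member of \<open>\<B>\<close> is compact, so a measure in \<open>\<M>\<^sub>\<B>(X)\<close> lives on a compact set \<open>B \<in> \<B>\<close>;
  every continuous function is integrable for it, and \<open>\<bar>\<integral> f d\<mu>\<bar> \<le> |\<mu>|(B) sup\<^sub>B \<bar>f\<bar>\<close> gives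
  continuity of the functional. Conversely a continuous functional satisfies
  \<open>\<bar>F f\<bar> \<le> K sup\<^sub>B \<bar>f\<bar>\<close> for some closed, hence compact, \<open>B \<in> \<B>\<close>
  (lemma \<open>continuous_functional_bound\<close>), and surjectivity is the Riesz representation theorem for
  functionals of this kind. It is proved on the whole space \<open>X\<close>, so that no function has to be extended
  from \<open>B\<close>. First \<open>F\<close> is split as the difference of two positive functionals,
  \<open>F\<^sup>+ f = sup {F g | 0 \<le> g \<le> f}\<close> and \<open>F\<^sup>+ - F\<close>, on the cone of nonnegative continuous functions. A
  positive functional \<open>I\<close> gives an outer measure: \<open>I\<close> is extended to limits of increasing sequences of
  continuous functions, and a set is measured by the infimum of \<open>I\<close> over the limits that
  dominate its indicator. Open sets are measurable in the sense of Caratheodory, because in a metric space their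
  indicator is an increasing limit of continuous functions (lemma \<open>outer_split_open\<close>). Cutting \<open>f\<close> into horizontal slices shows that
  \<open>I\<close> is integration against the resulting measure (lemma \<open>functional_eq_integral\<close>).

  Injectivity holds since finite Borel measures on a metric space are determined by their integrals of
  bounded continuous functions: these approximate indicators of closed sets
  (lemma \<open>finite_borel_measure_eqI\<close>).

  Two facts about signed measures support this. The positive and the negative variation of a
  finite signed Borel measure are finite measures whose difference is the signed measure (Jordan
  decomposition). And closed regularity is automatic in metric spaces, so that membership in
  \<open>\<M>\<^sub>\<B>(X)\<close> is just a support condition (lemma \<open>measure_space_on_iff\<close>).\<close>

section \<open>Jordan decomposition\<close>

lemma signed_union:
  assumes "finite_signed_borel \<mu>" "A \<in> sets borel" "B \<in> sets borel" "A \<inter> B = {}"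
  shows "\<mu> (A \<union> B) = \<mu> A + \<mu> B"
proof -
  have "disjoint_family (binaryset A B)" "range (binaryset A B) \<subseteq> sets borel"
    using assms by (auto simp: disjoint_family_on_def binaryset_def)
  then have "(\<lambda>n. \<mu> (binaryset A B n)) sums \<mu> (\<Union>n. binaryset A B n)"
    using assms(1) unfolding finite_signed_borel_def by blast
  moreover have "(\<lambda>n. \<mu> (binaryset A B n)) sums (\<mu> A + \<mu> B)"
    using assms(1) by (intro binaryset_sums) (simp add: finite_signed_borel_def)
  ultimately show ?thesis using sums_unique2 UN_binaryset_eq by metis
qed

lemma signed_diff:
  assumes "finite_signed_borel \<mu>" "A \<in> sets borel" "B \<in> sets borel" "B \<subseteq> A"
  shows "\<mu> (A - B) = \<mu> A - \<mu> B"
proof -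
  have *: "(A - B) \<union> B = A" using assms by blast
  have "\<mu> ((A - B) \<union> B) = \<mu> (A - B) + \<mu> B" using assms by (intro signed_union) auto
  then show ?thesis unfolding * by simp
qed

lemma finite_signed_borel_uminus:
  "finite_signed_borel \<mu> \<Longrightarrow> finite_signed_borel (\<lambda>A. - \<mu> A)"
  unfolding finite_signed_borel_def by (auto intro: sums_minus)

definition upper_variation :: "('a::topological_space set \<Rightarrow> real) \<Rightarrow> 'a set \<Rightarrow> ennreal" where
  "upper_variation \<mu> A = (SUP E\<in>{E \<in> sets borel. E \<subseteq> A}. ennreal (\<mu> E))"

lemma upper_variation_upper:
  "E \<in> sets borel \<Longrightarrow> E \<subseteq> A \<Longrightarrow> ennreal (\<mu> E) \<le> upper_variation \<mu> A"
  unfolding upper_variation_def by (rule SUP_upper) blast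

text \<open>Sets nearly attaining the two suprema may be united; a set of negative measure is replaced
  by the empty set, which is what the truncation of \<open>ennreal\<close> amounts to.\<close>

lemma upper_variation_superadditive:
  assumes mu: "finite_signed_borel \<mu>" and disj: "A \<inter> B = {}"
  shows "upper_variation \<mu> A + upper_variation \<mu> B \<le> upper_variation \<mu> (A \<union> B)"
proof -
  let ?S = "\<lambda>A. {E \<in> sets borel. E \<subseteq> A}"
  have ne: "?S A \<noteq> {}" for A :: "'a set" by blast
  have le: "ennreal (\<mu> E) + ennreal (\<mu> F) \<le> upper_variation \<mu> (A \<union> B)"
    if "E \<in> ?S A" "F \<in> ?S B" for E F
  proof -
    have *: "ennreal (\<mu> E) \<le> upper_variation \<mu> (A \<union> B)" "ennreal (\<mu> F) \<le> upper_variation \<mu> (A \<union> B)"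
      using that by (auto intro: upper_variation_upper)
    show ?thesis
    proof (cases "\<mu> E \<ge> 0 \<and> \<mu> F \<ge> 0")
      case True
      have "\<mu> (E \<union> F) = \<mu> E + \<mu> F" using that disj by (intro signed_union mu) auto
      then have "ennreal (\<mu> E) + ennreal (\<mu> F) = ennreal (\<mu> (E \<union> F))"
        using True by (simp add: ennreal_plus)
      also have "\<dots> \<le> upper_variation \<mu> (A \<union> B)"
        using that by (intro upper_variation_upper) auto
      finally show ?thesis .
    next
      case False
      then consider "ennreal (\<mu> E) = 0" | "ennreal (\<mu> F) = 0" by (metis ennreal_neg linear)
      then show ?thesis using * by cases simp_all
    qed
  qed
  show ?thesis
    unfolding upper_variation_def[of \<mu> A] upper_variation_def[of \<mu> B]
    by (simp only: ennreal_SUP_add_left[symmetric, OF ne] ennreal_SUP_add_right[OF ne])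
      (intro SUP_least le)
qed

text \<open>Superadditivity bounds every partial sum by the value of the union. For the converse,
  a subset \<open>E\<close> of the union is cut into the pieces \<open>E \<inter> A\<^sub>n\<close>.\<close>

lemma upper_variation_countably_additive:
  assumes mu: "finite_signed_borel \<mu>"
  shows "countably_additive (sets borel) (upper_variation \<mu>)"
  unfolding countably_additive_def
proof (intro allI impI antisym)
  fix A :: "nat \<Rightarrow> 'a set" assume A: "range A \<subseteq> sets borel" "disjoint_family A"
  have mono: "upper_variation \<mu> B \<le> upper_variation \<mu> C" if "B \<subseteq> C" for B C
    using that unfolding upper_variation_def by (intro SUP_subset_mono) auto
  have part: "(\<Sum>i<n. upper_variation \<mu> (A i)) \<le> upper_variation \<mu> (\<Union>i<n. A i)" for n
  proof (induction n)
    case (Suc n)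
    have "(\<Union>i<n. A i) \<inter> A n = {}"
      using disjoint_family_onD[OF A(2), of _ n] by (force simp: disjoint_iff)
    then have "upper_variation \<mu> (\<Union>i<n. A i) + upper_variation \<mu> (A n)
        \<le> upper_variation \<mu> ((\<Union>i<n. A i) \<union> A n)"
      by (rule upper_variation_superadditive[OF mu])
    also have "(\<Union>i<n. A i) \<union> A n = (\<Union>i<Suc n. A i)" by (auto simp: lessThan_Suc)
    finally show ?case using order_trans[OF add_right_mono[OF Suc.IH]] by simp
  qed simp
  show "(\<Sum>i. upper_variation \<mu> (A i)) \<le> upper_variation \<mu> (\<Union>i. A i)"
    by (intro suminf_le_const summableI order_trans[OF part] mono) auto
  show "upper_variation \<mu> (\<Union>i. A i) \<le> (\<Sum>i. upper_variation \<mu> (A i))"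
    unfolding upper_variation_def[of \<mu> "\<Union>i. A i"]
  proof (rule SUP_least)
    fix E assume E: "E \<in> {E \<in> sets borel. E \<subseteq> (\<Union>i. A i)}"
    \<comment> \<open>The signed series of the pieces is dominated by the series of their positive parts.\<close>
    define g where "g n = max 0 (\<mu> (E \<inter> A n))" for n
    have "range (\<lambda>n. E \<inter> A n) \<subseteq> sets borel" "disjoint_family (\<lambda>n. E \<inter> A n)"
      using E A by (auto simp: disjoint_family_on_def)
    then have "(\<lambda>n. \<mu> (E \<inter> A n)) sums \<mu> (\<Union>n. E \<inter> A n)"
      using mu unfolding finite_signed_borel_def by blast
    moreover have "(\<Union>n. E \<inter> A n) = E" using E by blast
    ultimately have sums: "(\<lambda>n. \<mu> (E \<inter> A n)) sums \<mu> E" by simp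
    have "ennreal (\<mu> E) \<le> (\<Sum>n. ennreal (g n))"
    proof (cases "(\<Sum>n. ennreal (g n)) = top")
      case False
      then have "summable g" by (intro summable_suminf_not_top) (auto simp: g_def)
      then have "\<mu> E \<le> suminf g"
        using sums by (intro sums_le[OF _ sums summable_sums]) (auto simp: g_def)
      moreover have "(\<Sum>n. ennreal (g n)) = ennreal (suminf g)"
        using False by (intro suminf_ennreal) (auto simp: g_def)
      ultimately show ?thesis by (simp add: ennreal_leI)
    qed simp
    also have "\<dots> \<le> (\<Sum>i. upper_variation \<mu> (A i))"
    proof (intro suminf_le summableI)
      fix n
      have "ennreal (g n) = ennreal (\<mu> (E \<inter> A n))" by (simp add: g_def max_def ennreal_neg)
      also have "\<dots> \<le> upper_variation \<mu> (A n)" using E A by (intro upper_variation_upper) auto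
      finally show "ennreal (g n) \<le> upper_variation \<mu> (A n)" .
    qed
    finally show "ennreal (\<mu> E) \<le> (\<Sum>i. upper_variation \<mu> (A i))" .
  qed
qed

lemma sets_pos_variation [simp, measurable_cong]: "sets (pos_variation \<mu>) = sets borel"
  unfolding pos_variation_def using sets.sets_measure_of_eq[of borel] by simp

lemma space_pos_variation [simp]: "space (pos_variation \<mu>) = UNIV"
  using sets_eq_imp_space_eq[OF sets_pos_variation] by simp

lemma emeasure_pos_variation:
  assumes mu: "finite_signed_borel \<mu>" and A: "A \<in> sets borel"
  shows "emeasure (pos_variation \<mu>) A = upper_variation \<mu> A"
  unfolding pos_variation_def upper_variation_def[symmetric]
proof (rule emeasure_measure_of_sigma[OF _ _ upper_variation_countably_additive[OF mu] A])
  show "sigma_algebra UNIV (sets (borel :: 'a measure))"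
    using sets.sigma_algebra_axioms[of borel] by simp
  have "upper_variation \<mu> {} = 0"
    using mu unfolding upper_variation_def finite_signed_borel_def by (simp add: subset_empty SUP_eq_iff)
  then show "positive (sets borel) (upper_variation \<mu>)" by (simp add: positive_def)
qed

text \<open>If the positive variation of \<open>A\<close> is infinite, some \<open>E \<subseteq> A\<close> has measure above \<open>\<bar>\<mu> A\<bar> + 1\<close>, so
  both \<open>E\<close> and \<open>A - E\<close> have measure at least 1 in absolute value, and one of them has infinite variation
  again. Iterating peels off infinitely many disjoint sets of absolute measure at least 1, and the
  series of their measures cannot converge.\<close>

lemma finite_measure_pos_variation:
  assumes mu: "finite_signed_borel \<mu>"
  shows "finite_measure (pos_variation \<mu>)"
proof (rule finite_measureI, rule notI)
  let ?V = "emeasure (pos_variation \<mu>)"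
  assume "?V (space (pos_variation \<mu>)) = \<infinity>"
  then have top: "?V UNIV = top" by simp
  let ?P = "\<lambda>A. A \<in> sets borel \<and> ?V A = top"
  have step: "\<exists>B. ?P B \<and> B \<subseteq> A \<and> 1 \<le> \<bar>\<mu> (A - B)\<bar>" if "?P A" for A
  proof -
    have "ennreal (\<bar>\<mu> A\<bar> + 1) < upper_variation \<mu> A"
      using that emeasure_pos_variation[OF mu] by (metis ennreal_less_top)
    then obtain E where E: "E \<in> sets borel" "E \<subseteq> A" "ennreal (\<bar>\<mu> A\<bar> + 1) < ennreal (\<mu> E)"
      unfolding upper_variation_def less_SUP_iff by blast
    then have big: "\<bar>\<mu> A\<bar> + 1 < \<mu> E" by (subst (asm) ennreal_less_iff) auto
    have "?V E + ?V (A - E) = ?V (E \<union> (A - E))" using E that by (intro plus_emeasure) auto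
    also have "E \<union> (A - E) = A" using E by blast
    finally have "?V E + ?V (A - E) = top" using that by simp
    then consider "?V E = top" | "?V (A - E) = top" by (auto simp: ennreal_add_eq_top)
    then show ?thesis
    proof cases
      case 1
      have "1 \<le> \<bar>\<mu> (A - E)\<bar>" using big signed_diff[OF mu _ E(1,2)] that by auto
      then show ?thesis using 1 E by blast
    next
      case 2
      have "A - (A - E) = E" using E by blast
      then show ?thesis using 2 E(1) that big by (intro exI[of _ "A - E"]) auto
    qed
  qed
  obtain A where A: "\<And>n. ?P (A n)" "\<And>n. A (Suc n) \<subseteq> A n \<and> 1 \<le> \<bar>\<mu> (A n - A (Suc n))\<bar>"
  proof (rule dependent_nat_choice[of "\<lambda>_. ?P" "\<lambda>_ A B. B \<subseteq> A \<and> 1 \<le> \<bar>\<mu> (A - B)\<bar>", THEN exE])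
    show "\<exists>A. ?P A" using top by (intro exI[of _ UNIV]) simp
  qed (use step in blast)+
  define D where "D n = A n - A (Suc n)" for n
  have "decseq A" using A(2) by (intro decseq_SucI) blast
  then have "D m \<inter> D n = {}" if "m < n" for m n
    unfolding D_def using decseqD[OF \<open>decseq A\<close> Suc_leI[OF that]] by blast
  then have "disjoint_family D"
    unfolding disjoint_family_on_def by (metis inf_commute nat_neq_iff)
  moreover have "range D \<subseteq> sets borel" using A(1) by (auto simp: D_def)
  ultimately have "(\<lambda>n. \<mu> (D n)) sums \<mu> (\<Union>n. D n)"
    using mu unfolding finite_signed_borel_def by blast
  then have "(\<lambda>n. \<mu> (D n)) \<longlonglongrightarrow> 0" using sums_summable summable_LIMSEQ_zero by blast
  then have "eventually (\<lambda>n. \<bar>\<mu> (D n)\<bar> < 1) sequentially"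
    using order_tendstoD(2)[OF tendsto_rabs_zero, of "\<lambda>n. \<mu> (D n)" sequentially 1] by simp
  then show False using A(2) unfolding D_def by (auto simp: eventually_sequentially not_less[symmetric])
qed

text \<open>For \<open>E \<subseteq> A\<close> one has \<open>\<mu> E = \<mu> A - \<mu> (A - E)\<close>; the supremum over \<open>E\<close> turns the left side into the
  positive variation and the right side into \<open>\<mu> A\<close> plus the negative variation.\<close>

lemma measure_pos_variation_minus:
  assumes mu: "finite_signed_borel \<mu>" and A: "A \<in> sets borel"
  shows "measure (pos_variation \<mu>) A - measure (neg_variation \<mu>) A = \<mu> A"
proof -
  have le: "measure (pos_variation \<nu>) A \<le> \<nu> A + measure (pos_variation (\<lambda>A. - \<nu> A)) A"
    if nu: "finite_signed_borel \<nu>" for \<nu>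
  proof -
    let ?\<nu> = "\<lambda>A. - \<nu> A"
    note nu' = finite_signed_borel_uminus[OF nu]
    interpret P: finite_measure "pos_variation \<nu>" by (rule finite_measure_pos_variation[OF nu])
    interpret N: finite_measure "pos_variation ?\<nu>" by (rule finite_measure_pos_variation[OF nu'])
    define q where "q = measure (pos_variation ?\<nu>) A"
    have q: "- \<nu> E \<le> q" if "E \<in> sets borel" "E \<subseteq> A" for E
    proof -
      have "ennreal (- \<nu> E) \<le> ennreal q"
        unfolding q_def N.emeasure_eq_measure[symmetric] emeasure_pos_variation[OF nu' A]
        by (rule upper_variation_upper[OF that])
      then show ?thesis by (simp add: q_def ennreal_le_iff)
    qed
    have "ennreal (measure (pos_variation \<nu>) A) \<le> ennreal (\<nu> A + q)"
      unfolding P.emeasure_eq_measure[symmetric] emeasure_pos_variation[OF nu A] upper_variation_def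
    proof (intro SUP_least ennreal_leI)
      fix E assume "E \<in> {E \<in> sets borel. E \<subseteq> A}"
      then show "\<nu> E \<le> \<nu> A + q" using q[of "A - E"] signed_diff[OF nu A, of E] A by auto
    qed
    moreover have "0 \<le> \<nu> A + q" using q[OF A] by simp
    ultimately show ?thesis by (simp add: q_def ennreal_le_iff)
  qed
  show ?thesis
    using le[OF mu] le[OF finite_signed_borel_uminus[OF mu]] by (simp add: neg_variation_def)
qed

lemma finite_measure_neg_variation:
  "finite_signed_borel \<mu> \<Longrightarrow> finite_measure (neg_variation \<mu>)"
  unfolding neg_variation_def by (intro finite_measure_pos_variation finite_signed_borel_uminus)

lemma sets_neg_variation [simp, measurable_cong]: "sets (neg_variation \<mu>) = sets borel"
  and space_neg_variation [simp]: "space (neg_variation \<mu>) = UNIV"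
  by (simp_all add: neg_variation_def)

lemma total_variation_eq_0_iff:
  assumes mu: "finite_signed_borel \<mu>" and A: "A \<in> sets borel"
  shows "total_variation \<mu> A = 0 \<longleftrightarrow> (\<forall>E\<in>sets borel. E \<subseteq> A \<longrightarrow> \<mu> E = 0)"
proof -
  note mu' = finite_signed_borel_uminus[OF mu]
  have zero: "upper_variation \<nu> A = 0 \<longleftrightarrow> (\<forall>E\<in>sets borel. E \<subseteq> A \<longrightarrow> \<nu> E \<le> 0)" for \<nu>
  proof -
    have "upper_variation \<nu> A \<le> 0 \<longleftrightarrow> (\<forall>E\<in>sets borel. E \<subseteq> A \<longrightarrow> \<nu> E \<le> 0)"
      unfolding upper_variation_def SUP_le_iff by (auto simp: ennreal_eq_0_iff)
    then show ?thesis by simp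
  qed
  have "total_variation \<mu> A = 0 \<longleftrightarrow> upper_variation \<mu> A = 0 \<and> upper_variation (\<lambda>A. - \<mu> A) A = 0"
    unfolding total_variation_def neg_variation_def emeasure_pos_variation[OF mu A]
      emeasure_pos_variation[OF mu' A] by (rule add_eq_0_iff_both_eq_0; simp)
  also have "\<dots> \<longleftrightarrow> (\<forall>E\<in>sets borel. E \<subseteq> A \<longrightarrow> \<mu> E = 0)"
    unfolding zero by fastforce
  finally show ?thesis .
qed

section \<open>Linearity of the integral in the measure\<close>

lemma tendsto_sum_list:
  fixes f :: "'b \<Rightarrow> 'c \<Rightarrow> real"
  assumes "\<And>x. x \<in> set L \<Longrightarrow> (f x \<longlongrightarrow> l x) F"
  shows "((\<lambda>n. \<Sum>x\<leftarrow>L. f x n) \<longlongrightarrow> (\<Sum>x\<leftarrow>L. l x)) F"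
  using assms by (induction L) (auto intro!: tendsto_add)

lemma simple_function_cong_sets:
  "sets M = sets N \<Longrightarrow> simple_function M f \<longleftrightarrow> simple_function N f"
  using sets_eq_imp_space_eq[of M N] unfolding simple_function_def by simp

text \<open>A linear relation between finite measures carries over to integrals: this is clear for simple
  functions, and one sequence of simple functions approximates \<open>f\<close> for all the measures at once. Additivity
  and homogeneity of the signed integral in the measure are instances, although the Jordan
  decomposition itself is not additive.\<close>

lemma integral_linear_relation:
  fixes L :: "(real \<times> 'a::topological_space measure) list" and f :: "'a \<Rightarrow> real"
  assumes fin: "\<And>c M. (c, M) \<in> set L \<Longrightarrow> finite_measure M \<and> sets M = sets borel \<and> integrable M f"
    and f: "f \<in> borel_measurable borel"
    and zero: "\<And>A. A \<in> sets borel \<Longrightarrow> (\<Sum>(c, M)\<leftarrow>L. c * measure M A) = 0"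
  shows "(\<Sum>(c, M)\<leftarrow>L. c * integral\<^sup>L M f) = 0"
proof -
  from borel_measurable_implies_sequence_metric[OF f, of 0] obtain s where
    s: "\<And>i. simple_function borel (s i)" "\<And>x. (\<lambda>i. s i x) \<longlonglongrightarrow> f x"
      "\<And>i x. norm (s i x) \<le> 2 * norm (f x)"
    by (auto simp: space_borel)
  have simple: "integral\<^sup>L M (s i) = (\<Sum>y\<in>range (s i). y * measure M (s i -` {y}))"
    if "(c, M) \<in> set L" for c M i
  proof -
    interpret finite_measure M using fin[OF that] by blast
    have M: "sets M = sets borel" "space M = UNIV"
      using fin[OF that] sets_eq_imp_space_eq[of M borel] by auto
    have "simple_function M (s i)"
      using s(1)[of i] simple_function_cong_sets[OF M(1), of "s i"] by simp
    then have "Bochner_Integration.simple_bochner_integrable M (s i)"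
      by (simp add: simple_bochner_integrable.simps)
    then have "integral\<^sup>L M (s i) = Bochner_Integration.simple_bochner_integral M (s i)"
      by (rule simple_bochner_integrable_eq_integral[symmetric])
    also have "\<dots> = (\<Sum>y\<in>range (s i). y * measure M (s i -` {y}))"
      unfolding simple_bochner_integral_def M(2)
      by (auto intro!: sum.cong simp: vimage_def mult.commute)
    finally show ?thesis .
  qed
  have "(\<Sum>(c, M)\<leftarrow>L. c * integral\<^sup>L M (s i)) = 0" for i
  proof -
    have "(\<Sum>(c, M)\<leftarrow>L. c * integral\<^sup>L M (s i))
        = (\<Sum>(c, M)\<leftarrow>L. \<Sum>y\<in>range (s i). y * (c * measure M (s i -` {y})))"
      by (intro arg_cong[of _ _ sum_list] map_cong refl)
        (auto simp: simple sum_distrib_left mult.left_commute)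
    also have "\<dots> = (\<Sum>y\<in>range (s i). \<Sum>(c, M)\<leftarrow>L. y * (c * measure M (s i -` {y})))"
      by (induction L) (auto simp: sum.distrib)
    also have "\<dots> = (\<Sum>y\<in>range (s i). y * (\<Sum>(c, M)\<leftarrow>L. c * measure M (s i -` {y})))"
      by (simp add: sum_list_const_mult case_prod_unfold)
    also have "\<dots> = 0"
    proof (intro sum.neutral ballI)
      fix y
      have "s i -` {y} \<in> sets borel" using simple_functionD(2)[OF s(1), of i "{y}"] by simp
      then show "y * (\<Sum>(c, M)\<leftarrow>L. c * measure M (s i -` {y})) = 0" by (simp add: zero)
    qed
    finally show ?thesis .
  qed
  moreover have "(\<lambda>i. \<Sum>(c, M)\<leftarrow>L. c * integral\<^sup>L M (s i)) \<longlonglongrightarrow> (\<Sum>(c, M)\<leftarrow>L. c * integral\<^sup>L M f)"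
    unfolding case_prod_unfold
  proof (rule tendsto_sum_list, intro tendsto_intros)
    fix p assume "p \<in> set L"
    then obtain c M where p: "p = (c, M)" "(c, M) \<in> set L" by (metis surj_pair)
    have M: "sets M = sets borel" "integrable M f" using fin[OF p(2)] by auto
    have "(\<lambda>i. integral\<^sup>L M (s i)) \<longlonglongrightarrow> integral\<^sup>L M f"
    proof (rule integral_dominated_convergence)
      show "integrable M (\<lambda>x. 2 * norm (f x))" using M(2) by auto
      show "s i \<in> borel_measurable M" for i
        using borel_measurable_simple_function[OF s(1)[of i]] measurable_cong_sets[OF M(1) refl] by blast
    qed (use M s in auto)
    then show "(\<lambda>i. integral\<^sup>L (snd p) (s i)) \<longlonglongrightarrow> integral\<^sup>L (snd p) f" by (simp add: p)
  qed
  ultimately show ?thesis by (simp add: LIMSEQ_const_iff)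
qed

text \<open>The signed integral can be computed from any decomposition of \<open>\<mu>\<close> into a difference of
  finite measures.\<close>

lemma signed_integral_difference:
  fixes f :: "'a::topological_space \<Rightarrow> real"
  assumes mu: "finite_signed_borel \<mu>"
    and M: "finite_measure M" "sets M = sets borel" and N: "finite_measure N" "sets N = sets borel"
    and eq: "\<And>A. A \<in> sets borel \<Longrightarrow> \<mu> A = measure M A - measure N A"
    and f: "f \<in> borel_measurable borel" "integrable M f" "integrable N f"
      "integrable (pos_variation \<mu>) f" "integrable (neg_variation \<mu>) f"
  shows "signed_integral \<mu> f = integral\<^sup>L M f - integral\<^sup>L N f"
proof -
  have "(\<Sum>(c, M)\<leftarrow>[(1, pos_variation \<mu>), (-1, neg_variation \<mu>), (-1, M), (1, N)].
      c * integral\<^sup>L M f) = 0"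
  proof (rule integral_linear_relation)
    fix A :: "'a set" assume A: "A \<in> sets borel"
    show "(\<Sum>(c, M)\<leftarrow>[(1, pos_variation \<mu>), (-1, neg_variation \<mu>), (-1, M), (1, N)]. c * measure M A) = 0"
      using measure_pos_variation_minus[OF mu A] eq[OF A] by simp
  next
    fix c K assume "(c, K) \<in> set [(1, pos_variation \<mu>), (-1, neg_variation \<mu>), (-1, M), (1, N)]"
    then consider "K = pos_variation \<mu>" | "K = neg_variation \<mu>" | "K = M" | "K = N" by auto
    then show "finite_measure K \<and> sets K = sets borel \<and> integrable K f"
      by cases (simp_all add: finite_measure_pos_variation[OF mu] finite_measure_neg_variation[OF mu] M N f)
  qed (rule f(1))
  then show ?thesis by (simp add: signed_integral_def)
qed

lemma signed_integral_add:
  fixes f :: "'a::topological_space \<Rightarrow> real"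
  assumes mu: "finite_signed_borel \<mu>" and nu: "finite_signed_borel \<nu>"
    and sum: "finite_signed_borel (\<lambda>A. \<mu> A + \<nu> A)"
    and f: "f \<in> borel_measurable borel" "integrable (pos_variation \<mu>) f" "integrable (neg_variation \<mu>) f"
      "integrable (pos_variation \<nu>) f" "integrable (neg_variation \<nu>) f"
      "integrable (pos_variation (\<lambda>A. \<mu> A + \<nu> A)) f" "integrable (neg_variation (\<lambda>A. \<mu> A + \<nu> A)) f"
  shows "signed_integral (\<lambda>A. \<mu> A + \<nu> A) f = signed_integral \<mu> f + signed_integral \<nu> f"
proof -
  let ?s = "\<lambda>A. \<mu> A + \<nu> A"
  have "(\<Sum>(c, M)\<leftarrow>[(1, pos_variation ?s), (-1, neg_variation ?s), (-1, pos_variation \<mu>),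
      (1, neg_variation \<mu>), (-1, pos_variation \<nu>), (1, neg_variation \<nu>)]. c * integral\<^sup>L M f) = 0"
  proof (rule integral_linear_relation)
    fix A :: "'a set" assume A: "A \<in> sets borel"
    show "(\<Sum>(c, M)\<leftarrow>[(1, pos_variation ?s), (-1, neg_variation ?s), (-1, pos_variation \<mu>),
      (1, neg_variation \<mu>), (-1, pos_variation \<nu>), (1, neg_variation \<nu>)]. c * measure M A) = 0"
      using measure_pos_variation_minus[OF mu A] measure_pos_variation_minus[OF nu A]
        measure_pos_variation_minus[OF sum A] by simp
  qed (use assms in \<open>auto simp: finite_measure_pos_variation finite_measure_neg_variation\<close>)
  then show ?thesis by (simp add: signed_integral_def)
qed

lemma signed_integral_scale:
  fixes f :: "'a::topological_space \<Rightarrow> real"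
  assumes mu: "finite_signed_borel \<mu>" and cmu: "finite_signed_borel (\<lambda>A. c * \<mu> A)"
    and f: "f \<in> borel_measurable borel" "integrable (pos_variation \<mu>) f" "integrable (neg_variation \<mu>) f"
      "integrable (pos_variation (\<lambda>A. c * \<mu> A)) f" "integrable (neg_variation (\<lambda>A. c * \<mu> A)) f"
  shows "signed_integral (\<lambda>A. c * \<mu> A) f = c * signed_integral \<mu> f"
proof -
  let ?s = "\<lambda>A. c * \<mu> A"
  have "(\<Sum>(c, M)\<leftarrow>[(1, pos_variation ?s), (-1, neg_variation ?s), (-c, pos_variation \<mu>),
      (c, neg_variation \<mu>)]. c * integral\<^sup>L M f) = 0"
  proof (rule integral_linear_relation)
    fix A :: "'a set" assume A: "A \<in> sets borel"
    show "(\<Sum>(c, M)\<leftarrow>[(1, pos_variation ?s), (-1, neg_variation ?s), (-c, pos_variation \<mu>),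
      (c, neg_variation \<mu>)]. c * measure M A) = 0"
      using measure_pos_variation_minus[OF cmu A]
      unfolding measure_pos_variation_minus[OF mu A, symmetric] by (simp add: right_diff_distrib)
  qed (use assms in \<open>auto simp: finite_measure_pos_variation finite_measure_neg_variation\<close>)
  then show ?thesis by (simp add: signed_integral_def algebra_simps)
qed

section \<open>Closed regularity\<close>

text \<open>The sets with this approximation property form a \<open>\<sigma>\<close>-algebra, and a closed set belongs to it
  because it is the intersection of its decreasing open \<open>1/n\<close>-neighborhoods.\<close>

lemma finite_borel_measure_closed_regular:
  fixes M :: "'a::metric_space measure"
  assumes fin: "finite_measure M" and M: "sets M = sets borel" and A: "A \<in> sets borel"
  shows "\<forall>\<epsilon>>0. \<exists>C U. closed C \<and> open U \<and> C \<subseteq> A \<and> A \<subseteq> U \<and> measure M (U - C) < \<epsilon>"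
proof -
  interpret finite_measure M by fact
  have [measurable_cong, simp]: "sets M = sets borel" by fact
  have "A \<in> sigma_sets UNIV (Collect closed)"
    using A unfolding borel_eq_closed by simp
  then show ?thesis
  proof induction
    case (Basic A)
    then have A: "closed A" by simp
    define U where "U n = (\<Union>x\<in>A. ball x (inverse (real (Suc n))))" for n
    have "decseq U"
      unfolding U_def decseq_def by (intro allI impI UN_mono order_refl subset_ball) (simp add: field_simps)
    have "(\<Inter>n. U n) = A"
    proof
      show "(\<Inter>n. U n) \<subseteq> A"
      proof
        fix x assume x: "x \<in> (\<Inter>n. U n)"
        have "\<exists>y\<in>A. dist y x < e" if e: "e > 0" for e
        proof -
          obtain n where "inverse (real (Suc n)) < e" using reals_Archimedean[OF e] by blast
          moreover obtain y where "y \<in> A" "dist y x < inverse (real (Suc n))"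
            using x unfolding U_def by auto
          ultimately show ?thesis by force
        qed
        then show "x \<in> A" using closed_approachable[OF A] by blast
      qed
    qed (auto simp: U_def)
    moreover have "(\<lambda>n. measure M (U n)) \<longlonglongrightarrow> measure M (\<Inter>n. U n)"
      by (rule finite_Lim_measure_decseq[OF _ \<open>decseq U\<close>]) (auto simp: U_def intro!: borel_open)
    ultimately have lim: "(\<lambda>n. measure M (U n)) \<longlonglongrightarrow> measure M A" by simp
    show ?case
    proof (intro allI impI)
      fix \<epsilon> :: real assume "\<epsilon> > 0"
      then have "eventually (\<lambda>n. measure M (U n) < measure M A + \<epsilon>) sequentially"
        by (intro order_tendstoD(2)[OF lim]) simp
      then obtain n where n: "measure M (U n) < measure M A + \<epsilon>" by (auto simp: eventually_sequentially)
      have U: "open (U n)" "A \<subseteq> U n" by (auto simp: U_def)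
      have "measure M (U n - A) = measure M (U n) - measure M A"
        using U A by (intro finite_measure_Diff) auto
      then show "\<exists>C U. closed C \<and> open U \<and> C \<subseteq> A \<and> A \<subseteq> U \<and> measure M (U - C) < \<epsilon>"
        using A U n by (intro exI[of _ A] exI[of _ "U n"]) auto
    qed
  next
    case Empty
    show ?case by (intro allI impI exI[of _ "{}"]) simp
  next
    case (Compl A)
    show ?case
    proof (intro allI impI)
      fix \<epsilon> :: real assume "\<epsilon> > 0"
      then obtain C U where "closed C" "open U" "C \<subseteq> A" "A \<subseteq> U" "measure M (U - C) < \<epsilon>"
        using Compl.IH by metis
      moreover have "(UNIV - C) - (UNIV - U) = U - C" by blast
      ultimately show "\<exists>C U. closed C \<and> open U \<and> C \<subseteq> UNIV - A \<and> UNIV - A \<subseteq> U \<and> measure M (U - C) < \<epsilon>"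
        by (intro exI[of _ "UNIV - U"] exI[of _ "UNIV - C"]) (auto intro: closed_Diff open_Diff)
    qed
  next
    case (Union A)
    show ?case
    proof (intro allI impI)
      fix \<epsilon> :: real assume "\<epsilon> > 0"
      then have "\<exists>C U. closed C \<and> open U \<and> C \<subseteq> A i \<and> A i \<subseteq> U \<and> measure M (U - C) < \<epsilon> / 2 * (1/2) ^ Suc i" for i
        by (intro Union.IH[of i, rule_format]) simp
      then obtain C U where CU: "\<And>i. closed (C i)" "\<And>i. open (U i)" "\<And>i. C i \<subseteq> A i" "\<And>i. A i \<subseteq> U i"
          "\<And>i. measure M (U i - C i) < \<epsilon> / 2 * (1/2) ^ Suc i"
        by metis
      have [measurable]: "C i \<in> sets borel" "U i \<in> sets borel" for i using CU by auto
      let ?U = "\<Union>i. U i"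
      have half: "(\<lambda>i. \<epsilon> / 2 * (1/2) ^ Suc i) sums (\<epsilon> / 2)"
        using sums_mult[OF power_half_series, of "\<epsilon> / 2"] by simp
      have summable: "summable (\<lambda>i. measure M (U i - C i))"
        using CU(5) by (intro summable_comparison_test'[OF sums_summable[OF half], of 0]) (auto intro: less_imp_le)
      have "measure M (?U - (\<Union>i. C i)) \<le> measure M (\<Union>i. U i - C i)"
        by (intro finite_measure_mono) auto
      also have "\<dots> \<le> (\<Sum>i. measure M (U i - C i))"
        using summable by (intro finite_measure_subadditive_countably) auto
      also have "\<dots> \<le> \<epsilon> / 2"
        using CU(5) by (intro sums_le[OF _ summable_sums[OF summable] half]) (auto intro: less_imp_le)
      finally have le: "measure M (?U - (\<Union>i. C i)) < \<epsilon>" using \<open>\<epsilon> > 0\<close> by simp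
      \<comment> \<open>The union of all the \<open>C i\<close> need not be closed; finitely many of them suffice by continuity from above.\<close>
      define D where "D n = ?U - (\<Union>i<n. C i)" for n
      have "decseq D" unfolding D_def decseq_def by (auto intro: less_le_trans)
      moreover have "(\<Inter>n. D n) = ?U - (\<Union>i. C i)" unfolding D_def by auto
      moreover have "range D \<subseteq> sets M" by (auto simp: D_def)
      ultimately have "(\<lambda>n. measure M (D n)) \<longlonglongrightarrow> measure M (?U - (\<Union>i. C i))"
        using finite_Lim_measure_decseq[of D] by simp
      then have "eventually (\<lambda>n. measure M (D n) < \<epsilon>) sequentially"
        using le by (rule order_tendstoD(2))
      then obtain n where "measure M (D n) < \<epsilon>" by (auto simp: eventually_sequentially)
      moreover have "closed (\<Union>i<n. C i)" "open ?U" using CU by (auto intro: closed_UN)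
      moreover have "(\<Union>i<n. C i) \<subseteq> (\<Union>i. A i)" "(\<Union>i. A i) \<subseteq> ?U"
        using CU(3,4) by (blast, intro UN_mono) auto
      ultimately show "\<exists>C U. closed C \<and> open U \<and> C \<subseteq> (\<Union>i. A i) \<and> (\<Union>i. A i) \<subseteq> U \<and> measure M (U - C) < \<epsilon>"
        unfolding D_def by (intro exI[of _ "\<Union>i<n. C i"] exI[of _ ?U] conjI)
    qed
  qed
qed

text \<open>The closed sets and the open sets obtained for the two variations are united and intersected,
  respectively.\<close>

lemma closed_regular_finite_signed_borel:
  fixes \<mu> :: "'a::metric_space set \<Rightarrow> real"
  assumes mu: "finite_signed_borel \<mu>"
  shows "closed_regular \<mu>"
  unfolding closed_regular_def
proof (intro ballI allI impI)
  fix A :: "'a set" and \<epsilon> :: real assume A: "A \<in> sets borel" and "\<epsilon> > 0"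
  interpret P: finite_measure "pos_variation \<mu>" by (rule finite_measure_pos_variation[OF mu])
  interpret N: finite_measure "neg_variation \<mu>" by (rule finite_measure_neg_variation[OF mu])
  have "\<epsilon> / 2 > 0" using \<open>\<epsilon> > 0\<close> by simp
  obtain C U where CU: "closed C" "open U" "C \<subseteq> A" "A \<subseteq> U" "measure (pos_variation \<mu>) (U - C) < \<epsilon> / 2"
    using finite_borel_measure_closed_regular[OF P.finite_measure_axioms _ A] \<open>\<epsilon> / 2 > 0\<close> sets_pos_variation by metis
  obtain D V where DV: "closed D" "open V" "D \<subseteq> A" "A \<subseteq> V" "measure (neg_variation \<mu>) (V - D) < \<epsilon> / 2"
    using finite_borel_measure_closed_regular[OF N.finite_measure_axioms _ A] \<open>\<epsilon> / 2 > 0\<close> sets_neg_variation by metis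
  let ?W = "(U \<inter> V) - (C \<union> D)"
  have "measure (pos_variation \<mu>) ?W \<le> measure (pos_variation \<mu>) (U - C)"
    using CU DV by (intro P.finite_measure_mono) auto
  moreover have "measure (neg_variation \<mu>) ?W \<le> measure (neg_variation \<mu>) (V - D)"
    using CU DV by (intro N.finite_measure_mono) auto
  ultimately have "measure (pos_variation \<mu>) ?W + measure (neg_variation \<mu>) ?W < \<epsilon>"
    using CU(5) DV(5) by simp
  then have "total_variation \<mu> ?W < ennreal \<epsilon>"
    unfolding total_variation_def P.emeasure_eq_measure N.emeasure_eq_measure
    by (simp add: ennreal_less_iff flip: ennreal_plus)
  then show "\<exists>C U. closed C \<and> open U \<and> C \<subseteq> A \<and> A \<subseteq> U \<and> total_variation \<mu> (U - C) < ennreal \<epsilon>"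
    using CU DV by (intro exI[of _ "C \<union> D"] exI[of _ "U \<inter> V"]) auto
qed

text \<open>The variations do not occur on the right side, which makes closure under linear combinations
  evident.\<close>

lemma measure_space_on_iff:
  fixes \<B> :: "'a::metric_space set set"
  shows "\<mu> \<in> measure_space_on \<B> \<longleftrightarrow> finite_signed_borel \<mu> \<and>
    (\<exists>B\<in>\<B>. closed B \<and> (\<forall>E\<in>sets borel. E \<inter> B = {} \<longrightarrow> \<mu> E = 0))"
proof -
  have "total_variation \<mu> (UNIV - B) = 0 \<longleftrightarrow> (\<forall>E\<in>sets borel. E \<inter> B = {} \<longrightarrow> \<mu> E = 0)"
    if "finite_signed_borel \<mu>" "closed B" for B
  proof -
    have "E \<subseteq> UNIV - B \<longleftrightarrow> E \<inter> B = {}" for E by blast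
    moreover have "UNIV - B \<in> sets borel" using that by auto
    ultimately show ?thesis using total_variation_eq_0_iff[OF that(1)] by simp
  qed
  then show ?thesis
    unfolding measure_space_on_def using closed_regular_finite_signed_borel by auto
qed

section \<open>Riesz representation of positive functionals\<close>

lemma continuous_bounded_on_compact:
  fixes f :: "'a::topological_space \<Rightarrow> real"
  assumes "compact B" "continuous_on UNIV f"
  obtains b where "0 < b" "\<And>x. x \<in> B \<Longrightarrow> \<bar>f x\<bar> \<le> b"
proof -
  have "bounded (f ` B)"
    using compact_imp_bounded[OF compact_continuous_image[OF continuous_on_subset[OF assms(2) subset_UNIV] assms(1)]] .
  then obtain b where "\<forall>x\<in>B. \<bar>f x\<bar> \<le> b" by (auto simp: bounded_iff)
  then show ?thesis by (intro that[of "max 1 b"]) (auto simp: le_max_iff_disj)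
qed

lemma AE_in_compact_support:
  fixes M :: "'a::metric_space measure"
  assumes "sets M = sets borel" "compact B" "emeasure M (UNIV - B) = 0"
  shows "AE x in M. x \<in> B"
proof -
  have "UNIV - B \<in> null_sets M"
    using assms compact_imp_closed[OF assms(2)] by (intro null_setsI) (simp_all add: open_Diff)
  from AE_not_in[OF this] show ?thesis by simp
qed

lemma integrable_of_compact_support:
  fixes f :: "'a::metric_space \<Rightarrow> real"
  assumes M: "finite_measure M" "sets M = sets borel" and B: "compact B" "emeasure M (UNIV - B) = 0"
    and f: "continuous_on UNIV f"
  shows "integrable M f"
proof -
  interpret finite_measure M by fact
  obtain b where b: "\<And>x. x \<in> B \<Longrightarrow> \<bar>f x\<bar> \<le> b"
    using continuous_bounded_on_compact[OF B(1) f] by blast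
  have "AE x in M. norm (f x) \<le> b"
    using AE_in_compact_support[OF M(2) B] by eventually_elim (use b in auto)
  moreover have "f \<in> borel_measurable M"
    using borel_measurable_continuous_onI[OF f] measurable_cong_sets[OF M(2) refl] by blast
  ultimately show ?thesis by (rule integrable_const_bound)
qed

definition cone :: "('a::topological_space \<Rightarrow> real) set" where
  "cone = {f. continuous_on UNIV f \<and> (\<forall>x. 0 \<le> f x)}"

lemma coneI: "continuous_on UNIV f \<Longrightarrow> (\<And>x. 0 \<le> f x) \<Longrightarrow> f \<in> cone"
  and coneD: "f \<in> cone \<Longrightarrow> continuous_on UNIV f" "f \<in> cone \<Longrightarrow> 0 \<le> f x"
  by (auto simp: cone_def)

text \<open>The slice \<open>min 1 (max 0 (t - k))\<close> of height 1 above level \<open>k\<close> is supported on \<open>{k < t}\<close>.\<close>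

lemma sum_slices:
  "0 \<le> t \<Longrightarrow> (\<Sum>k<n. min 1 (max 0 (t - real k))) = min (real n) t"
  by (induction n) auto

lemma sum_levels_le:
  "0 \<le> t \<Longrightarrow> (\<Sum>k<n. if real k < t then 1 else 0) \<le> t + (1::real)"
proof -
  assume "0 \<le> t"
  then have "(\<Sum>k<n. if real k < t then 1 else 0) \<le> min (real n) (t + 1)"
    by (induction n) auto
  then show ?thesis by simp
qed

text \<open>The functional is only used on the cone of nonnegative continuous functions, where the positive part
  of a signed functional is given by a supremum formula. The last assumption makes its values depend
  only on the values of functions on \<open>B\<close>.\<close>

locale positive_functional =
  fixes I :: "('a::metric_space \<Rightarrow> real) \<Rightarrow> real" and B :: "'a set" and K :: real
  assumes B: "compact B" "B \<noteq> {}"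
    and add: "f \<in> cone \<Longrightarrow> g \<in> cone \<Longrightarrow> I (\<lambda>x. f x + g x) = I f + I g"
    and scale: "0 \<le> c \<Longrightarrow> f \<in> cone \<Longrightarrow> I (\<lambda>x. c * f x) = c * I f"
    and nonneg: "f \<in> cone \<Longrightarrow> 0 \<le> I f"
    and bound: "f \<in> cone \<Longrightarrow> 0 \<le> s \<Longrightarrow> (\<And>x. x \<in> B \<Longrightarrow> f x \<le> s) \<Longrightarrow> I f \<le> K * s"
begin

text \<open>Only the values on \<open>B\<close> matter: the excess of \<open>f\<close> over \<open>g\<close> is a member of the cone that is at most \<open>e\<close>
  on \<open>B\<close>. The cone has no differences, so \<open>f - g\<close> is split into its positive and negative part.\<close>

lemma mono_approx:
  assumes f: "f \<in> cone" and g: "g \<in> cone" and e: "0 \<le> e" and le: "\<And>x. x \<in> B \<Longrightarrow> f x \<le> g x + e"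
  shows "I f \<le> I g + K * e"
proof -
  note cont = coneD(1)[OF f] coneD(1)[OF g]
  have r: "(\<lambda>x. max 0 (f x - g x)) \<in> cone" (is "?r \<in> _") by (intro coneI continuous_intros cont) simp
  have s: "(\<lambda>x. max 0 (g x - f x)) \<in> cone" (is "?s \<in> _") by (intro coneI continuous_intros cont) simp
  have "I f + I ?s = I (\<lambda>x. f x + ?s x)" by (rule add[OF f s, symmetric])
  also have "(\<lambda>x. f x + ?s x) = (\<lambda>x. g x + ?r x)" by (auto simp: fun_eq_iff max_def)
  also have "I \<dots> = I g + I ?r" by (rule add[OF g r])
  finally have "I f \<le> I g + I ?r" using nonneg[OF s] by simp
  also have "I ?r \<le> K * e" using le e by (intro bound[OF r]) (auto simp: algebra_simps)
  finally show ?thesis by simp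
qed

lemma mono: "f \<in> cone \<Longrightarrow> g \<in> cone \<Longrightarrow> (\<And>x. x \<in> B \<Longrightarrow> f x \<le> g x) \<Longrightarrow> I f \<le> I g"
  using mono_approx[of f g 0] by simp

lemma zero: "I (\<lambda>x. 0) = 0"
  using scale[of 0 "\<lambda>x. 0"] by (simp add: cone_def)

lemma sum: "finite J \<Longrightarrow> (\<And>j. j \<in> J \<Longrightarrow> f j \<in> cone) \<Longrightarrow> I (\<lambda>x. \<Sum>j\<in>J. f j x) = (\<Sum>j\<in>J. I (f j))"
proof (induction J rule: finite_induct)
  case (insert j J)
  have "(\<lambda>x. \<Sum>j\<in>J. f j x) \<in> cone"
    using insert.prems by (intro coneI continuous_on_sum sum_nonneg) (auto dest: coneD)
  then show ?case using insert by (simp add: add)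
qed (simp add: zero)

lemma K_nonneg: "0 \<le> K"
proof -
  have "0 \<le> I (\<lambda>x. 1)" by (intro nonneg) (simp add: cone_def)
  also have "\<dots> \<le> K * 1" by (intro bound) (auto simp: cone_def)
  finally show ?thesis by simp
qed

text \<open>The limits of these sequences dominate the indicator of \<open>A\<close>. The value 1 has to be reached at a finite
  stage, which spares any limit argument.\<close>

definition covers :: "'a set \<Rightarrow> (nat \<Rightarrow> 'a \<Rightarrow> real) set" where
  "covers A = {h. (\<forall>n. h n \<in> cone) \<and> (\<forall>x. incseq (\<lambda>n. h n x)) \<and> (\<forall>x\<in>A. \<exists>n. 1 \<le> h n x)}"

definition outer :: "'a set \<Rightarrow> ennreal" where
  "outer A = (INF h\<in>covers A. SUP n. ennreal (I (h n)))"

lemma coversD: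
  assumes "h \<in> covers A"
  shows "h n \<in> cone" and "m \<le> n \<Longrightarrow> h m x \<le> h n x" and "x \<in> A \<Longrightarrow> \<exists>n. 1 \<le> h n x"
  using assms by (auto simp: covers_def incseq_def)

lemma outer_le: "h \<in> covers A \<Longrightarrow> outer A \<le> (SUP n. ennreal (I (h n)))"
  unfolding outer_def by (rule INF_lower)

lemma outer_le_functional:
  assumes f: "f \<in> cone" and "\<And>x. x \<in> A \<Longrightarrow> 1 \<le> f x"
  shows "outer A \<le> ennreal (I f)"
  using outer_le[of "\<lambda>_. f" A] assms by (simp add: covers_def)

text \<open>A Dini argument: the open sets where \<open>f < h\<^sub>n + d\<close> increase with \<open>n\<close> and cover the compact set \<open>B\<close>, so
  one of them contains \<open>B\<close>, and then \<open>I f \<le> I h\<^sub>n + K d\<close>.\<close>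

lemma functional_le_outer:
  assumes f: "f \<in> cone" and le: "\<And>x. f x \<le> 1" and out: "\<And>x. x \<notin> A \<Longrightarrow> f x = 0"
  shows "ennreal (I f) \<le> outer A"
  unfolding outer_def
proof (rule INF_greatest)
  fix h assume h: "h \<in> covers A"
  note hc = coneD(1)[OF coversD(1)[OF h]]
  show "ennreal (I f) \<le> (SUP n. ennreal (I (h n)))"
  proof (rule ennreal_le_epsilon)
    fix e :: real assume "0 < e"
    define d where "d = e / (K + 1)"
    have d: "0 < d" "K * d \<le> e"
      using \<open>0 < e\<close> K_nonneg by (auto simp: d_def field_simps)
    let ?U = "\<lambda>n. {x. f x < h n x + d}"
    have cover: "B \<subseteq> (\<Union>n\<in>UNIV. ?U n)"
    proof
      fix x
      show "x \<in> (\<Union>n\<in>UNIV. ?U n)"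
      proof (cases "x \<in> A")
        case True
        then obtain n where "1 \<le> h n x" using coversD(3)[OF h] by blast
        then have "f x < h n x + d" using le[of x] d(1) by linarith
        then show ?thesis by blast
      next
        case False
        then have "f x < h 0 x + d" using out coneD(2)[OF coversD(1)[OF h], of 0 x] d(1) by simp
        then show ?thesis by blast
      qed
    qed
    have opn: "open (?U n)" for n
      by (intro open_Collect_less continuous_intros coneD(1)[OF f] hc)
    obtain J where "J \<subseteq> UNIV" and J: "finite J" "B \<subseteq> (\<Union>n\<in>J. ?U n)"
      by (rule compactE_image[OF B(1) opn cover])
    define n where "n = Max (insert 0 J)"
    have "I f \<le> I (h n) + K * d"
    proof (rule mono_approx[OF f coversD(1)[OF h]])
      fix x assume "x \<in> B"
      then obtain m where m: "m \<in> J" "f x < h m x + d" using J(2) by blast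
      have "m \<le> n" using J(1) m(1) by (simp add: n_def)
      then show "f x \<le> h n x + d" using coversD(2)[OF h, of m n x] m(2) by linarith
    qed (use d in simp)
    also have "\<dots> \<le> I (h n) + e" using d by simp
    finally have "ennreal (I f) \<le> ennreal (I (h n) + e)" by (rule ennreal_leI)
    also have "\<dots> = ennreal (I (h n)) + ennreal e"
      using nonneg[OF coversD(1)[OF h]] \<open>0 < e\<close> by (intro ennreal_plus) auto
    also have "\<dots> \<le> (SUP n. ennreal (I (h n))) + ennreal e" by (intro add_right_mono SUP_upper) simp
    finally show "ennreal (I f) \<le> (SUP n. ennreal (I (h n))) + ennreal e" .
  qed
qed

lemma outer_mono: "A \<subseteq> A' \<Longrightarrow> outer A \<le> outer A'"
  unfolding outer_def by (rule INF_superset_mono) (auto simp: covers_def)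

lemma outer_empty: "outer {} = 0"
proof -
  have "outer {} \<le> ennreal (I (\<lambda>x. 0))" by (rule outer_le_functional) (auto simp: cone_def)
  then show ?thesis by (simp add: zero)
qed

text \<open>If \<open>h\<^sup>i\<close> covers \<open>A\<^sub>i\<close>, then the diagonal sums \<open>\<Sum>i<n. h\<^sup>i\<^sub>n\<close> increase and cover the union.\<close>

lemma outer_countably_subadditive: "outer (\<Union>i. A i) \<le> (\<Sum>i. outer (A i))"
proof (rule ennreal_le_epsilon)
  fix e :: real assume fin: "(\<Sum>i. outer (A i)) < top" and e: "0 < e"
  have "\<exists>h\<in>covers (A i). (SUP n. ennreal (I (h n))) < outer (A i) + ennreal (e * (1/2) ^ Suc i)" for i
  proof -
    have "outer (A i) < top" using fin by (rule ennreal_suminf_lessD)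
    then have "outer (A i) < outer (A i) + ennreal (e * (1/2) ^ Suc i)"
      using e by (simp add: ennreal_add_left_cancel_less less_top)
    then show ?thesis unfolding outer_def[of "A i"] by (subst (asm) (1) INF_less_iff)
  qed
  then obtain h where h: "\<And>i. h i \<in> covers (A i)"
      "\<And>i. (SUP n. ennreal (I (h i n))) < outer (A i) + ennreal (e * (1/2) ^ Suc i)" by metis
  note hp = coneD(2)[OF coversD(1)[OF h(1)]]
  define H where "H n x = (\<Sum>i<n. h i n x)" for n x
  have "H \<in> covers (\<Union>i. A i)"
    unfolding covers_def mem_Collect_eq
  proof (intro conjI allI ballI)
    show "H n \<in> cone" for n
      unfolding H_def using h(1)
      by (intro coneI continuous_on_sum sum_nonneg) (auto dest: coversD coneD)
    show "incseq (\<lambda>n. H n x)" for x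
    proof (rule incseq_SucI)
      fix n
      have "H n x \<le> (\<Sum>i<n. h i (Suc n) x)"
        unfolding H_def by (intro sum_mono coversD(2)[OF h(1)]) simp
      also have "\<dots> \<le> H (Suc n) x" unfolding H_def using hp by simp
      finally show "H n x \<le> H (Suc n) x" .
    qed
    fix x assume "x \<in> (\<Union>i. A i)"
    then obtain i where "x \<in> A i" by blast
    then obtain n where n: "1 \<le> h i n x" using coversD(3)[OF h(1)] by blast
    let ?m = "max n (Suc i)"
    have "1 \<le> h i ?m x" using n coversD(2)[OF h(1)[of i], of n ?m x] by simp
    also have "\<dots> \<le> H ?m x" unfolding H_def using hp by (intro member_le_sum) auto
    finally show "\<exists>n. 1 \<le> H n x" by blast
  qed
  then have "outer (\<Union>i. A i) \<le> (SUP n. ennreal (I (H n)))" by (rule outer_le)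
  also have "\<dots> \<le> (\<Sum>i. SUP n. ennreal (I (h i n)))"
  proof (rule SUP_least)
    fix n
    have "I (H n) = (\<Sum>i<n. I (h i n))"
      unfolding H_def using coversD(1)[OF h(1)] by (intro sum) auto
    then have "ennreal (I (H n)) = (\<Sum>i<n. ennreal (I (h i n)))"
      using nonneg[OF coversD(1)[OF h(1)]] by (simp add: sum_ennreal)
    also have "\<dots> \<le> (\<Sum>i<n. SUP n. ennreal (I (h i n)))" by (intro sum_mono SUP_upper) simp
    also have "\<dots> \<le> (\<Sum>i. SUP n. ennreal (I (h i n)))" by (intro sum_le_suminf summableI) auto
    finally show "ennreal (I (H n)) \<le> (\<Sum>i. SUP n. ennreal (I (h i n)))" .
  qed
  also have "\<dots> \<le> (\<Sum>i. outer (A i) + ennreal (e * (1/2) ^ Suc i))"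
    using h(2) by (intro suminf_le summableI less_imp_le)
  also have "\<dots> = (\<Sum>i. outer (A i)) + (\<Sum>i. ennreal (e * (1/2) ^ Suc i))"
    by (rule suminf_add[symmetric]) (rule summableI)+
  also have "(\<Sum>i. ennreal (e * (1/2) ^ Suc i)) = ennreal e"
    using sums_mult[OF power_half_series, of e] e by (intro suminf_ennreal_eq) auto
  finally show "outer (\<Union>i. A i) \<le> (\<Sum>i. outer (A i)) + ennreal e" .
qed

lemma outer_measure_space: "outer_measure_space (Pow UNIV) outer"
  unfolding outer_measure_space_def positive_def increasing_def countably_subadditive_def
  by (simp add: outer_empty outer_mono outer_countably_subadditive)

text \<open>There are continuous \<open>\<phi>\<^sub>n\<close> increasing to the indicator of \<open>G\<close>. If \<open>h\<close> covers \<open>T\<close>, then \<open>h\<^sub>n \<phi>\<^sub>n\<close>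
  covers \<open>G \<inter> T\<close>, and for each fixed \<open>k\<close> the sequence \<open>h\<^sub>n (1 - \<phi>\<^sub>k)\<close> covers \<open>T - G\<close>. For \<open>n \<ge> k\<close> the sum
  \<open>I (h\<^sub>k \<phi>\<^sub>k) + I (h\<^sub>n (1 - \<phi>\<^sub>k))\<close> is at most \<open>I h\<^sub>n\<close>.\<close>

lemma outer_split_open:
  assumes G: "open G"
  shows "outer (G \<inter> T) + outer (T - G) \<le> outer T"
proof -
  \<comment> \<open>The distance to the empty set is 0 by convention, so the whole space needs its own function.\<close>
  define g where "g x = (if G = UNIV then 1 else infdist x (- G))" for x
  have g: "continuous_on UNIV g" "\<And>x. 0 \<le> g x"
    unfolding g_def by (cases "G = UNIV"; auto intro: continuous_intros infdist_nonneg)+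
  have g_pos: "0 < g x \<longleftrightarrow> x \<in> G" for x
  proof (cases "G = UNIV")
    case False
    then have "x \<in> - G \<longleftrightarrow> infdist x (- G) = 0"
      using G by (intro in_closed_iff_infdist_zero) auto
    then show ?thesis using False infdist_nonneg[of x "- G"] by (auto simp: g_def)
  qed (simp add: g_def)
  define \<phi> where "\<phi> n x = min 1 (real n * g x)" for n x
  have phi: "0 \<le> \<phi> n x" "\<phi> n x \<le> 1" for n x
    using g(2)[of x] by (simp_all add: \<phi>_def)
  have phi_mono: "\<phi> m x \<le> \<phi> n x" if "m \<le> n" for m n x
    unfolding \<phi>_def using that g(2)[of x] by (intro min.mono mult_right_mono) auto
  have phic: "continuous_on UNIV (\<phi> n)" for n
    unfolding \<phi>_def by (intro continuous_intros g)
  show ?thesis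
    unfolding outer_def[of T]
  proof (rule INF_greatest)
    fix h assume h: "h \<in> covers T"
    note hp = coneD(2)[OF coversD(1)[OF h]] and hc = coneD(1)[OF coversD(1)[OF h]]
    have inner: "(\<lambda>x. h n x * \<phi> k x) \<in> cone" for n k
      by (intro coneI continuous_intros hc phic mult_nonneg_nonneg hp phi)
    have rest: "(\<lambda>x. h n x * (1 - \<phi> k x)) \<in> cone" for n k
      using phi by (intro coneI continuous_intros hc phic mult_nonneg_nonneg hp) auto
    have split: "I (h n) = I (\<lambda>x. h n x * \<phi> k x) + I (\<lambda>x. h n x * (1 - \<phi> k x))" for n k
      by (simp add: add[OF inner rest, symmetric] flip: distrib_left)
    let ?S = "SUP n. ennreal (I (h n))"
    have "(\<lambda>n x. h n x * \<phi> n x) \<in> covers (G \<inter> T)"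
      unfolding covers_def mem_Collect_eq
    proof (intro conjI allI ballI inner)
      show "incseq (\<lambda>n. h n x * \<phi> n x)" for x
        by (intro incseq_SucI mult_mono coversD(2)[OF h] phi phi_mono hp) auto
      fix x assume x: "x \<in> G \<inter> T"
      then obtain n where n: "1 \<le> h n x" using coversD(3)[OF h] by blast
      obtain m where "1 / g x \<le> real m" using real_arch_simple by blast
      then have m: "\<phi> m x = 1" using x g_pos[of x] by (simp add: \<phi>_def field_simps)
      have "1 \<le> h (max m n) x" using n coversD(2)[OF h, of n "max m n" x] by simp
      moreover have "\<phi> (max m n) x = 1" using m phi(2)[of "max m n" x] phi_mono[of m "max m n" x] by simp
      ultimately show "\<exists>n. 1 \<le> h n x * \<phi> n x" by (intro exI[of _ "max m n"]) simp
    qed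
    then have "outer (G \<inter> T) + outer (T - G) \<le> (SUP k. ennreal (I (\<lambda>x. h k x * \<phi> k x))) + outer (T - G)"
      by (intro add_right_mono outer_le)
    also have "\<dots> = (SUP k. ennreal (I (\<lambda>x. h k x * \<phi> k x)) + outer (T - G))"
      by (intro ennreal_SUP_add_left[symmetric]) simp
    also have "\<dots> \<le> ?S"
    proof (rule SUP_least)
      fix k
      have "(\<lambda>n x. h (k + n) x * (1 - \<phi> k x)) \<in> covers (T - G)"
        unfolding covers_def mem_Collect_eq
      proof (intro conjI allI ballI rest)
        show "incseq (\<lambda>n. h (k + n) x * (1 - \<phi> k x))" for x
          using phi by (intro incseq_SucI mult_right_mono coversD(2)[OF h]) auto
        fix x assume x: "x \<in> T - G"
        then obtain n where n: "1 \<le> h n x" using coversD(3)[OF h] by blast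
        have "g x = 0" using x g_pos[of x] g(2)[of x] by auto
        then have "\<phi> k x = 0" by (simp add: \<phi>_def)
        then show "\<exists>n. 1 \<le> h (k + n) x * (1 - \<phi> k x)"
          using n coversD(2)[OF h, of n "k + n" x] by (intro exI[of _ n]) simp
      qed
      then have "ennreal (I (\<lambda>x. h k x * \<phi> k x)) + outer (T - G)
          \<le> ennreal (I (\<lambda>x. h k x * \<phi> k x)) + (SUP n. ennreal (I (\<lambda>x. h (k + n) x * (1 - \<phi> k x))))"
        by (intro add_left_mono outer_le)
      also have "\<dots> = (SUP n. ennreal (I (\<lambda>x. h k x * \<phi> k x)) + ennreal (I (\<lambda>x. h (k + n) x * (1 - \<phi> k x))))"
        by (intro ennreal_SUP_add_right) simp
      also have "\<dots> \<le> ?S"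
      proof (rule SUP_least)
        fix n
        have "I (\<lambda>x. h k x * \<phi> k x) \<le> I (\<lambda>x. h (k + n) x * \<phi> k x)"
          by (intro mono inner mult_right_mono coversD(2)[OF h] phi) simp
        then have "I (\<lambda>x. h k x * \<phi> k x) + I (\<lambda>x. h (k + n) x * (1 - \<phi> k x)) \<le> I (h (k + n))"
          unfolding split[of "k + n" k] by simp
        then have "ennreal (I (\<lambda>x. h k x * \<phi> k x)) + ennreal (I (\<lambda>x. h (k + n) x * (1 - \<phi> k x))) \<le> ennreal (I (h (k + n)))"
          using nonneg[OF inner] nonneg[OF rest] by (simp add: ennreal_leI flip: ennreal_plus)
        also have "\<dots> \<le> ?S" by (rule SUP_upper) simp
        finally show "ennreal (I (\<lambda>x. h k x * \<phi> k x)) + ennreal (I (\<lambda>x. h (k + n) x * (1 - \<phi> k x))) \<le> ?S" .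
      qed
      finally show "ennreal (I (\<lambda>x. h k x * \<phi> k x)) + outer (T - G) \<le> ?S" .
    qed
    finally show "outer (G \<inter> T) + outer (T - G) \<le> ?S" .
  qed
qed

text \<open>Caratheodory: the measurable sets form a \<open>\<sigma>\<close>-algebra that contains the open sets.\<close>

lemma measure_space_outer: "measure_space UNIV (sets borel) outer"
proof -
  interpret P: sigma_algebra UNIV "Pow (UNIV :: 'a set)" by (rule sigma_algebra_Pow)
  let ?L = "lambda_system UNIV (Pow UNIV) outer"
  have L: "measure_space UNIV ?L outer" by (rule P.caratheodory_lemma[OF outer_measure_space])
  then have sL: "sigma_algebra UNIV ?L" by (simp add: measure_space_def)
  have sub: "outer (S \<union> T) \<le> outer S + outer T" if "S \<inter> T = {}" for S T
  proof -
    have "positive (Pow UNIV) outer" "countably_subadditive (Pow UNIV) outer"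
      using outer_measure_space by (auto simp: outer_measure_space_def)
    then have "subadditive (Pow UNIV) outer" by (rule P.countably_subadditive_subadditive)
    then show ?thesis using that by (auto simp: subadditive_def)
  qed
  have "G \<in> ?L" if G: "open G" for G
    unfolding lambda_system_def
  proof (intro CollectI conjI ballI antisym)
    fix T :: "'a set"
    have T: "(UNIV - G) \<inter> T = T - G" "(G \<inter> T) \<union> (T - G) = T" by auto
    show "outer (G \<inter> T) + outer ((UNIV - G) \<inter> T) \<le> outer T"
      unfolding T by (rule outer_split_open[OF G])
    show "outer T \<le> outer (G \<inter> T) + outer ((UNIV - G) \<inter> T)"
      using sub[of "G \<inter> T" "T - G"] unfolding T by auto
  qed simp
  then have "sets borel \<subseteq> ?L"
    unfolding sets_borel by (intro sigma_algebra.sigma_sets_subset[OF sL]) auto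
  then show ?thesis
    using sets.sigma_algebra_axioms[of borel] by (intro measure_down[OF L]) simp_all
qed

definition riesz_measure :: "'a measure" where
  "riesz_measure = measure_of UNIV (sets borel) outer"

lemma sets_riesz_measure [simp, measurable_cong]: "sets riesz_measure = sets borel"
  unfolding riesz_measure_def using sets.sets_measure_of_eq[of borel] by simp

lemma space_riesz_measure [simp]: "space riesz_measure = UNIV"
  using sets_eq_imp_space_eq[OF sets_riesz_measure] by simp

lemma emeasure_riesz_measure: "A \<in> sets borel \<Longrightarrow> emeasure riesz_measure A = outer A"
  using measure_space_outer unfolding riesz_measure_def measure_space_def
  by (intro emeasure_measure_of_sigma) auto

lemma emeasure_riesz_measure_UNIV: "emeasure riesz_measure UNIV = ennreal (I (\<lambda>x. 1))"
proof -
  have "(\<lambda>x. 1) \<in> cone" by (simp add: cone_def)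
  then have "outer UNIV = ennreal (I (\<lambda>x. 1))"
    by (intro antisym outer_le_functional functional_le_outer) auto
  then show ?thesis by (simp add: emeasure_riesz_measure)
qed

lemma finite_measure_riesz_measure: "finite_measure riesz_measure"
  by (rule finite_measureI) (simp add: emeasure_riesz_measure_UNIV)

lemma measure_riesz_measure_UNIV: "measure riesz_measure UNIV = I (\<lambda>x. 1)"
  using emeasure_riesz_measure_UNIV nonneg[of "\<lambda>x. 1"] by (simp add: measure_def cone_def)

text \<open>The multiples \<open>n \<cdot> infdist x B\<close> cover the complement of \<open>B\<close> and vanish on \<open>B\<close>, so that \<open>I\<close> is 0 on them.\<close>

lemma riesz_measure_support: "emeasure riesz_measure (UNIV - B) = 0"
proof -
  have cl: "closed B" by (rule compact_imp_closed[OF B(1)])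
  define h where "h n x = real n * infdist x B" for n x
  have hc: "h n \<in> cone" for n
    unfolding h_def by (intro coneI continuous_intros mult_nonneg_nonneg infdist_nonneg) simp
  have "h \<in> covers (UNIV - B)"
    unfolding covers_def mem_Collect_eq
  proof (intro conjI allI ballI hc)
    show "incseq (\<lambda>n. h n x)" for x
      unfolding h_def by (intro incseq_SucI mult_right_mono infdist_nonneg) simp
    fix x assume "x \<in> UNIV - B"
    then have "0 < infdist x B" using in_closed_iff_infdist_zero[OF cl B(2), of x] infdist_nonneg[of x B] by auto
    moreover obtain n where "1 / infdist x B \<le> real n" using real_arch_simple by blast
    ultimately have "1 \<le> h n x" by (simp add: h_def field_simps)
    then show "\<exists>n. 1 \<le> h n x" by blast
  qed
  moreover have "I (h n) \<le> 0" for n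
    using bound[OF hc, of 0 n] by (simp add: h_def)
  ultimately have "outer (UNIV - B) \<le> 0"
    by (intro order_trans[OF outer_le]) (auto intro!: SUP_least simp: ennreal_neg)
  then show ?thesis using cl by (simp add: emeasure_riesz_measure borel_open open_Diff)
qed

lemma integrable_riesz_measure:
  fixes f :: "'a \<Rightarrow> real"
  shows "continuous_on UNIV f \<Longrightarrow> integrable riesz_measure f"
  by (rule integrable_of_compact_support[OF finite_measure_riesz_measure sets_riesz_measure B(1) riesz_measure_support])

text \<open>Up to a factor \<open>d\<close>, \<open>f\<close> is on \<open>B\<close> a sum of slices \<open>\<phi>\<^sub>k\<close> of height 1, and \<open>I \<phi>\<^sub>k\<close> is at most the measure of
  the open set \<open>{f > k d}\<close> that supports it. The sum of the indicators of these sets is at most \<open>f/d + 1\<close>.\<close>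

lemma functional_le_integral:
  assumes f: "f \<in> cone"
  shows "I f \<le> integral\<^sup>L riesz_measure f"
proof -
  interpret M: finite_measure riesz_measure by (rule finite_measure_riesz_measure)
  note fc = coneD(1)[OF f] and fp = coneD(2)[OF f]
  obtain b where b: "\<And>x. x \<in> B \<Longrightarrow> f x \<le> b"
    using continuous_bounded_on_compact[OF B(1) fc] by (metis abs_le_D1)
  have step: "I f \<le> integral\<^sup>L riesz_measure f + d * measure riesz_measure UNIV" if d: "0 < d" for d
  proof -
    obtain n where n: "b / d \<le> real n" using real_arch_simple by blast
    define \<phi> where "\<phi> k x = min 1 (max 0 (f x / d - real k))" for k x
    have phi: "\<phi> k \<in> cone" for k
      unfolding \<phi>_def using d by (intro coneI continuous_intros fc) auto
    let ?L = "\<lambda>k. {x. real k < f x / d}"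
    have L: "open (?L k)" for k by (intro open_Collect_less continuous_intros fc) (use d in auto)
    have slice: "I (\<phi> k) \<le> measure riesz_measure (?L k)" for k
    proof -
      have "ennreal (I (\<phi> k)) \<le> outer (?L k)"
        by (rule functional_le_outer[OF phi]) (auto simp: \<phi>_def)
      also have "\<dots> = ennreal (measure riesz_measure (?L k))"
        using L by (simp add: emeasure_riesz_measure[symmetric] M.emeasure_eq_measure)
      finally show ?thesis by (simp add: ennreal_le_iff)
    qed
    have sumc: "(\<lambda>x. \<Sum>k<n. \<phi> k x) \<in> cone"
      by (intro coneI continuous_on_sum sum_nonneg coneD[OF phi])
    have "I f \<le> I (\<lambda>x. d * (\<Sum>k<n. \<phi> k x))"
    proof (rule mono[OF f])
      show "(\<lambda>x. d * (\<Sum>k<n. \<phi> k x)) \<in> cone"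
        using d sumc by (intro coneI continuous_intros coneD(1)[OF phi] mult_nonneg_nonneg coneD(2)[OF sumc]) auto
      fix x assume "x \<in> B"
      then have "f x / d \<le> real n" using b[of x] d n by (meson divide_right_mono less_imp_le order_trans)
      moreover have "(\<Sum>k<n. \<phi> k x) = min (real n) (f x / d)"
        unfolding \<phi>_def using fp d by (intro sum_slices) simp
      ultimately show "f x \<le> d * (\<Sum>k<n. \<phi> k x)" using d by simp
    qed
    also have "\<dots> = d * (\<Sum>k<n. I (\<phi> k))"
      using d phi by (simp add: scale[OF _ sumc] sum)
    also have "\<dots> \<le> d * (\<Sum>k<n. measure riesz_measure (?L k))"
      using d slice by (intro mult_left_mono sum_mono) auto
    also have "\<dots> = integral\<^sup>L riesz_measure (\<lambda>x. d * (\<Sum>k<n. indicator (?L k) x))"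
      using L by (simp add: M.emeasure_eq_measure)
    also have "\<dots> \<le> integral\<^sup>L riesz_measure (\<lambda>x. f x + d)"
    proof (rule integral_mono)
      show "integrable riesz_measure (\<lambda>x. d * (\<Sum>k<n. indicator (?L k) x))"
        using L by (intro integrable_mult_right Bochner_Integration.integrable_sum integrable_real_indicator)
          (auto simp: M.emeasure_eq_measure)
      show "integrable riesz_measure (\<lambda>x. f x + d)"
        by (intro integrable_riesz_measure continuous_intros fc)
      fix x
      have "(\<Sum>k<n. indicator (?L k) x) = (\<Sum>k<n. if real k < f x / d then 1 else (0::real))"
        by (intro sum.cong) (auto simp: indicator_def)
      also have "\<dots> \<le> f x / d + 1" using fp[of x] d by (intro sum_levels_le) simp
      finally have "d * (\<Sum>k<n. indicator (?L k) x) \<le> d * (f x / d + 1)" using d by (intro mult_left_mono) auto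
      then show "d * (\<Sum>k<n. indicator (?L k) x) \<le> f x + d" using d by (simp add: distrib_left)
    qed
    also have "\<dots> = integral\<^sup>L riesz_measure f + d * measure riesz_measure UNIV"
      using integrable_riesz_measure[OF fc] by (simp add: mult.commute)
    finally show ?thesis .
  qed
  show ?thesis
  proof (rule field_le_epsilon)
    fix e :: real assume e: "0 < e"
    let ?m = "measure riesz_measure UNIV"
    have "I f \<le> integral\<^sup>L riesz_measure f + e / (?m + 1) * ?m"
      using e by (intro step divide_pos_pos) (auto intro: add_nonneg_pos)
    also have "e / (?m + 1) * ?m \<le> e" using e by (simp add: divide_simps add_nonneg_pos) 
    finally show "I f \<le> integral\<^sup>L riesz_measure f + e" by simp
  qed
qed

text \<open>The reverse inequality is the previous one for \<open>b - f\<close>, where \<open>b\<close> bounds \<open>f\<close> on \<open>B\<close>, because both sides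
  agree on constants.\<close>

lemma functional_eq_integral:
  assumes f: "f \<in> cone"
  shows "I f = integral\<^sup>L riesz_measure f"
proof (rule antisym[OF functional_le_integral[OF f]])
  interpret M: finite_measure riesz_measure by (rule finite_measure_riesz_measure)
  note fc = coneD(1)[OF f]
  obtain b where b: "0 < b" "\<And>x. x \<in> B \<Longrightarrow> f x \<le> b"
    using continuous_bounded_on_compact[OF B(1) fc] by (metis abs_le_D1)
  let ?g = "\<lambda>x. max 0 (b - f x)"
  have g: "?g \<in> cone" by (intro coneI continuous_intros fc) simp
  have one: "(\<lambda>x. 1) \<in> cone" and bb: "(\<lambda>x. b * 1) \<in> cone" using b(1) by (auto simp: cone_def)
  have sum: "(\<lambda>x. f x + ?g x) \<in> cone" using coneD[OF f] by (intro coneI continuous_intros fc) (auto intro: add_nonneg_nonneg)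
  have "b * I (\<lambda>x. 1) = I (\<lambda>x. b * 1)" using scale[OF less_imp_le[OF b(1)] one] by simp
  also have "\<dots> \<le> I (\<lambda>x. f x + ?g x)" by (intro mono bb sum) auto
  also have "\<dots> = I f + I ?g" by (rule add[OF f g])
  also have "I ?g \<le> integral\<^sup>L riesz_measure ?g" by (rule functional_le_integral[OF g])
  finally have "b * I (\<lambda>x. 1) \<le> I f + integral\<^sup>L riesz_measure ?g" by simp
  moreover have "integral\<^sup>L riesz_measure f + integral\<^sup>L riesz_measure ?g = integral\<^sup>L riesz_measure (\<lambda>x. f x + ?g x)"
    by (intro Bochner_Integration.integral_add[symmetric] integrable_riesz_measure continuous_intros fc)
  moreover have "integral\<^sup>L riesz_measure (\<lambda>x. f x + ?g x) = integral\<^sup>L riesz_measure (\<lambda>x. b)"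
  proof (rule integral_cong_AE)
    show "AE x in riesz_measure. f x + ?g x = b"
      using AE_in_compact_support[OF sets_riesz_measure B(1) riesz_measure_support]
      by eventually_elim (use b in \<open>auto simp: max_def\<close>)
  qed (use integrable_riesz_measure[OF coneD(1)[OF sum]] in auto)
  moreover have "integral\<^sup>L riesz_measure (\<lambda>x. b) = b * I (\<lambda>x. 1)"
    unfolding measure_riesz_measure_UNIV[symmetric] by simp
  ultimately show "integral\<^sup>L riesz_measure f \<le> I f" by linarith
qed

end

section \<open>Riesz representation of bounded functionals\<close>

locale bounded_functional =
  fixes F :: "('a::metric_space \<Rightarrow> real) \<Rightarrow> real" and B :: "'a set" and K :: real
  assumes B: "compact B" "B \<noteq> {}"
    and add: "continuous_on UNIV f \<Longrightarrow> continuous_on UNIV g \<Longrightarrow> F (\<lambda>x. f x + g x) = F f + F g"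
    and scale: "continuous_on UNIV f \<Longrightarrow> F (\<lambda>x. c * f x) = c * F f"
    and bound: "continuous_on UNIV f \<Longrightarrow> 0 \<le> s \<Longrightarrow> (\<And>x. x \<in> B \<Longrightarrow> \<bar>f x\<bar> \<le> s) \<Longrightarrow> \<bar>F f\<bar> \<le> K * s"
begin

definition Fpos :: "('a \<Rightarrow> real) \<Rightarrow> real" where
  "Fpos f = (SUP g\<in>{g \<in> cone. \<forall>x. g x \<le> f x}. F g)"

definition Fneg :: "('a \<Rightarrow> real) \<Rightarrow> real" where
  "Fneg f = Fpos f - F f"

lemma zero: "F (\<lambda>x. 0) = 0"
  using scale[of "\<lambda>x. 0" 0] by simp

lemma bdd:
  assumes f: "f \<in> cone"
  shows "bdd_above (F ` {g \<in> cone. \<forall>x. g x \<le> f x})"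
proof -
  obtain b where b: "0 < b" "\<And>x. x \<in> B \<Longrightarrow> \<bar>f x\<bar> \<le> b"
    using continuous_bounded_on_compact[OF B(1) coneD(1)[OF f]] by blast
  have "F g \<le> K * b" if g: "g \<in> cone" "\<forall>x. g x \<le> f x" for g
  proof -
    have "\<bar>g x\<bar> \<le> b" if "x \<in> B" for x
      using b(2)[OF that] g(2) coneD(2)[OF g(1), of x] by (auto intro: order_trans)
    then have "\<bar>F g\<bar> \<le> K * b" using b(1) by (intro bound[OF coneD(1)[OF g(1)]]) auto
    then show ?thesis by simp
  qed
  then show ?thesis by (intro bdd_aboveI2) auto
qed

lemma Fpos_upper: "f \<in> cone \<Longrightarrow> g \<in> cone \<Longrightarrow> (\<And>x. g x \<le> f x) \<Longrightarrow> F g \<le> Fpos f"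
  unfolding Fpos_def by (rule cSUP_upper[OF _ bdd]) auto

lemma Fpos_least:
  assumes "f \<in> cone" "\<And>g. g \<in> cone \<Longrightarrow> (\<And>x. g x \<le> f x) \<Longrightarrow> F g \<le> c"
  shows "Fpos f \<le> c"
  unfolding Fpos_def
proof (rule cSUP_least)
  have "(\<lambda>x. 0) \<in> {g \<in> cone. \<forall>x. g x \<le> f x}" using assms(1) by (simp add: cone_def)
  then show "{g \<in> cone. \<forall>x. g x \<le> f x} \<noteq> {}" by blast
qed (use assms in auto)

lemma cone_add: "f \<in> cone \<Longrightarrow> g \<in> cone \<Longrightarrow> (\<lambda>x. f x + g x) \<in> cone"
  by (auto simp: cone_def intro: continuous_intros)

lemma cone_scale: "0 \<le> c \<Longrightarrow> f \<in> cone \<Longrightarrow> (\<lambda>x. c * f x) \<in> cone"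
  by (auto simp: cone_def intro: continuous_intros)

text \<open>A function \<open>u\<close> with \<open>0 \<le> u \<le> f + g\<close> decomposes as \<open>min u f\<close>, which is below \<open>f\<close>, and \<open>u - min u f\<close>,
  which is below \<open>g\<close>.\<close>

lemma Fpos_add:
  assumes f: "f \<in> cone" and g: "g \<in> cone"
  shows "Fpos (\<lambda>x. f x + g x) = Fpos f + Fpos g"
proof (rule antisym)
  show "Fpos (\<lambda>x. f x + g x) \<le> Fpos f + Fpos g"
  proof (rule Fpos_least[OF cone_add[OF f g]])
    fix u :: "'a \<Rightarrow> real" assume u: "u \<in> cone" "\<And>x. u x \<le> f x + g x"
    note cont = coneD(1)[OF f] coneD(1)[OF g] coneD(1)[OF u(1)]
    have u1: "(\<lambda>x. min (u x) (f x)) \<in> cone" (is "?u1 \<in> _")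
      using coneD(2)[OF f] coneD(2)[OF u(1)] by (intro coneI continuous_intros cont) auto
    have u2: "(\<lambda>x. u x - min (u x) (f x)) \<in> cone" (is "?u2 \<in> _")
      by (intro coneI continuous_intros cont) auto
    have "F u = F (\<lambda>x. ?u1 x + ?u2 x)" by simp
    also have "\<dots> = F ?u1 + F ?u2" using u1 u2 by (intro add coneD)
    also have "\<dots> \<le> Fpos f + Fpos g"
      using u(2) coneD(2)[OF g] by (intro add_mono Fpos_upper f g u1 u2) (auto simp: min_def algebra_simps)
    finally show "F u \<le> Fpos f + Fpos g" .
  qed
  have "F u \<le> Fpos (\<lambda>x. f x + g x) - Fpos g" if u: "u \<in> cone" "\<And>x. u x \<le> f x" for u
  proof -
    have "Fpos g \<le> Fpos (\<lambda>x. f x + g x) - F u"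
    proof (rule Fpos_least[OF g])
      fix v assume v: "v \<in> cone" "\<And>x. v x \<le> g x"
      have "F u + F v = F (\<lambda>x. u x + v x)" using u v by (intro add[symmetric] coneD)
      also have "\<dots> \<le> Fpos (\<lambda>x. f x + g x)"
        using u v by (intro Fpos_upper cone_add f g add_mono)
      finally show "F v \<le> Fpos (\<lambda>x. f x + g x) - F u" by simp
    qed
    then show ?thesis by simp
  qed
  then have "Fpos f \<le> Fpos (\<lambda>x. f x + g x) - Fpos g" by (rule Fpos_least[OF f])
  then show "Fpos f + Fpos g \<le> Fpos (\<lambda>x. f x + g x)" by simp
qed

lemma Fpos_scale:
  assumes c: "0 \<le> c" and f: "f \<in> cone"
  shows "Fpos (\<lambda>x. c * f x) = c * Fpos f"
proof (cases "c = 0")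
  case True
  have "Fpos (\<lambda>x. 0) = 0"
  proof (rule antisym)
    show "Fpos (\<lambda>x. 0) \<le> 0"
    proof (rule Fpos_least)
      fix g :: "'a \<Rightarrow> real" assume "g \<in> cone" "\<And>x. g x \<le> 0"
      then have "g = (\<lambda>x. 0)" by (auto simp: cone_def fun_eq_iff intro: antisym)
      then show "F g \<le> 0" by (simp add: zero)
    qed (simp add: cone_def)
    show "0 \<le> Fpos (\<lambda>x. 0)" using Fpos_upper[of "\<lambda>x. 0" "\<lambda>x. 0"] by (simp add: zero cone_def)
  qed
  then show ?thesis using True by simp
next
  case False
  have le: "c * Fpos f \<le> Fpos (\<lambda>x. c * f x)" if c: "0 < c" and f: "f \<in> cone" for c f
  proof -
    have "Fpos f \<le> Fpos (\<lambda>x. c * f x) / c"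
    proof (rule Fpos_least[OF f])
      fix g assume g: "g \<in> cone" "\<And>x. g x \<le> f x"
      have "c * F g = F (\<lambda>x. c * g x)" by (rule scale[OF coneD(1)[OF g(1)], symmetric])
      also have "\<dots> \<le> Fpos (\<lambda>x. c * f x)" using c g f by (intro Fpos_upper cone_scale mult_left_mono) auto
      finally show "F g \<le> Fpos (\<lambda>x. c * f x) / c" using c by (simp add: field_simps)
    qed
    then show ?thesis using c by (simp add: field_simps)
  qed
  have "0 < c" using False c by simp
  have "(1 / c) * Fpos (\<lambda>x. c * f x) \<le> Fpos (\<lambda>x. (1 / c) * (c * f x))"
    using \<open>0 < c\<close> by (intro le cone_scale c f) simp
  then have "Fpos (\<lambda>x. c * f x) \<le> c * Fpos f" using \<open>0 < c\<close> by (simp add: field_simps)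
  then show ?thesis using le[OF \<open>0 < c\<close> f] by simp
qed

lemma Fpos_bound:
  assumes f: "f \<in> cone" and s: "0 \<le> s" "\<And>x. x \<in> B \<Longrightarrow> f x \<le> s"
  shows "Fpos f \<le> K * s"
proof (rule Fpos_least[OF f])
  fix g assume g: "g \<in> cone" "\<And>x. g x \<le> f x"
  have "\<bar>F g\<bar> \<le> K * s"
    using coneD[OF g(1)] by (intro bound s) (auto intro: order_trans[OF g(2) s(2)])
  then show "F g \<le> K * s" by simp
qed

lemma positive_Fpos: "positive_functional Fpos B K"
proof
  fix f :: "'a \<Rightarrow> real" assume "f \<in> cone"
  then show "0 \<le> Fpos f" using Fpos_upper[of f "\<lambda>x. 0"] by (simp add: zero cone_def)
qed (use B Fpos_add Fpos_scale Fpos_bound in auto)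

lemma positive_Fneg: "positive_functional Fneg B (2 * K)"
proof
  fix f g :: "'a \<Rightarrow> real" assume f: "f \<in> cone"
  show "0 \<le> Fneg f" unfolding Fneg_def using Fpos_upper[OF f f] by simp
  show "Fneg f \<le> 2 * K * s" if s: "0 \<le> s" "\<And>x. x \<in> B \<Longrightarrow> f x \<le> s" for s
    unfolding Fneg_def using Fpos_bound[OF f s] bound[OF coneD(1)[OF f] s(1)] s(2) coneD(2)[OF f] by force
  show "Fneg (\<lambda>x. c * f x) = c * Fneg f" if "0 \<le> c" for c
    unfolding Fneg_def using that f by (simp add: Fpos_scale scale coneD right_diff_distrib)
  assume "g \<in> cone"
  then show "Fneg (\<lambda>x. f x + g x) = Fneg f + Fneg g"
    unfolding Fneg_def using f by (simp add: Fpos_add add coneD)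
qed (use B in auto)

lemma representation:
  obtains M N where "finite_measure M" "sets M = sets borel" "emeasure M (UNIV - B) = 0"
    "finite_measure N" "sets N = sets borel" "emeasure N (UNIV - B) = 0"
    "\<And>f. continuous_on UNIV f \<Longrightarrow> F f = integral\<^sup>L M f - integral\<^sup>L N f"
proof -
  interpret P: positive_functional Fpos B K by (rule positive_Fpos)
  interpret N: positive_functional Fneg B "2 * K" by (rule positive_Fneg)
  let ?P = P.riesz_measure and ?N = N.riesz_measure
  have "F f = integral\<^sup>L ?P f - integral\<^sup>L ?N f" if f: "continuous_on UNIV f" for f
  proof -
    let ?u = "\<lambda>x. max 0 (f x)" and ?v = "\<lambda>x. max 0 (- f x)"
    have u: "?u \<in> cone" and v: "?v \<in> cone" by (intro coneI continuous_intros f; simp)+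
    have uv: "f = (\<lambda>x. ?u x - ?v x)" by (auto simp: fun_eq_iff)
    have "F ?u = F (\<lambda>x. f x + ?v x)" by (rule arg_cong[of _ _ F]) auto
    also have "\<dots> = F f + F ?v" by (rule add[OF f coneD(1)[OF v]])
    finally have "F f = F ?u - F ?v" by simp
    also have "\<dots> = (integral\<^sup>L ?P ?u - integral\<^sup>L ?N ?u) - (integral\<^sup>L ?P ?v - integral\<^sup>L ?N ?v)"
      using u v by (simp add: P.functional_eq_integral[symmetric] N.functional_eq_integral[symmetric] Fneg_def)
    also have "\<dots> = (integral\<^sup>L ?P ?u - integral\<^sup>L ?P ?v) - (integral\<^sup>L ?N ?u - integral\<^sup>L ?N ?v)" by simp
    also have "\<dots> = integral\<^sup>L ?P (\<lambda>x. ?u x - ?v x) - integral\<^sup>L ?N (\<lambda>x. ?u x - ?v x)"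
      using coneD(1)[OF u] coneD(1)[OF v]
      by (intro arg_cong2[of _ _ _ _ "(-)"] Bochner_Integration.integral_diff[symmetric]
          P.integrable_riesz_measure N.integrable_riesz_measure)
    finally show ?thesis unfolding uv[symmetric] .
  qed
  then show ?thesis
    using that P.finite_measure_riesz_measure P.sets_riesz_measure P.riesz_measure_support
      N.finite_measure_riesz_measure N.sets_riesz_measure N.riesz_measure_support by blast
qed

end

section \<open>Linear bijections that match seminorms\<close>

text \<open>The families are indexed by a common set \<open>S\<close>, so that the basic neighborhoods of a point and
  of its image, given by the same finite subset of \<open>S\<close> and the same radius, correspond. Then so do the
  open sets.\<close>

lemma tvs_isomorphism_of_seminorms:
  fixes \<Phi> :: "('i \<Rightarrow> real) \<Rightarrow> ('j \<Rightarrow> real)" and p :: "'s \<Rightarrow> ('i \<Rightarrow> real) \<Rightarrow> ennreal"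
  assumes bij: "bij_betw \<Phi> V W"
    and add: "\<And>u v. u \<in> V \<Longrightarrow> v \<in> V \<Longrightarrow> \<Phi> (\<lambda>i. u i + v i) = (\<lambda>j. \<Phi> u j + \<Phi> v j)"
    and scale: "\<And>c u. u \<in> V \<Longrightarrow> \<Phi> (\<lambda>i. c * u i) = (\<lambda>j. c * \<Phi> u j)"
    and diff: "\<And>u v. u \<in> V \<Longrightarrow> v \<in> V \<Longrightarrow> (\<lambda>i. u i - v i) \<in> V"
    and smult: "\<And>c u. u \<in> V \<Longrightarrow> (\<lambda>i. c * u i) \<in> V"
    and semi: "\<And>s u. s \<in> S \<Longrightarrow> u \<in> V \<Longrightarrow> q s (\<Phi> u) = p s u"
  shows "tvs_isomorphism (seminorm_topology V (p ` S)) (seminorm_topology W (q ` S)) \<Phi>"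
proof -
  let ?X = "seminorm_topology V (p ` S)" and ?Y = "seminorm_topology W (q ` S)"
  have im: "\<Phi> ` V = W" and inj: "inj_on \<Phi> V" using bij by (auto simp: bij_betw_def)
  have Phi_diff: "\<Phi> (\<lambda>i. u i - v i) = (\<lambda>j. \<Phi> u j - \<Phi> v j)" if "u \<in> V" "v \<in> V" for u v
    using add[OF that(1) smult[OF that(2), of "-1"]] scale[OF that(2), of "-1"] by simp
  have nbhd: "{w \<in> W. \<forall>s\<in>R. q s (\<lambda>j. w j - \<Phi> u j) < ennreal r} = \<Phi> ` {v \<in> V. \<forall>s\<in>R. p s (\<lambda>i. v i - u i) < ennreal r}"
    if u: "u \<in> V" and R: "R \<subseteq> S" for u R r
  proof -
    have "q s (\<lambda>j. \<Phi> v j - \<Phi> u j) = p s (\<lambda>i. v i - u i)" if "v \<in> V" "s \<in> R" for v s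
      using semi[of s, OF _ diff[OF that(1) u]] Phi_diff[OF that(1) u] that R by auto
    then show ?thesis unfolding im[symmetric] by (auto simp: image_iff)
  qed
  have basis: "openin (seminorm_topology V' (p' ` S)) U \<longleftrightarrow> U \<subseteq> V' \<and>
     (\<forall>u\<in>U. \<exists>R r. finite R \<and> R \<subseteq> S \<and> 0 < r \<and> {v \<in> V'. \<forall>s\<in>R. p' s (\<lambda>i. v i - u i) < ennreal r} \<subseteq> U)"
    for V' U and p' :: "'s \<Rightarrow> ('k \<Rightarrow> real) \<Rightarrow> ennreal"
    unfolding openin_seminorm_topology
  proof (intro conj_cong refl ball_cong)
    fix u
    show "(\<exists>Q r. finite Q \<and> Q \<subseteq> p' ` S \<and> 0 < r \<and> {v \<in> V'. \<forall>p\<in>Q. p (\<lambda>i. v i - u i) < ennreal r} \<subseteq> U) \<longleftrightarrow>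
      (\<exists>R r. finite R \<and> R \<subseteq> S \<and> 0 < r \<and> {v \<in> V'. \<forall>s\<in>R. p' s (\<lambda>i. v i - u i) < ennreal r} \<subseteq> U)"
      (is "?l \<longleftrightarrow> ?r")
    proof
      assume ?l
      then obtain Q r where Q: "finite Q" "Q \<subseteq> p' ` S" "0 < r"
          "{v \<in> V'. \<forall>p\<in>Q. p (\<lambda>i. v i - u i) < ennreal r} \<subseteq> U" by blast
      obtain R where R: "R \<subseteq> S" "finite R" "Q = p' ` R" using finite_subset_image[OF Q(1,2)] by blast
      have "{v \<in> V'. \<forall>s\<in>R. p' s (\<lambda>i. v i - u i) < ennreal r} \<subseteq> U" using Q(4) unfolding R(3) by auto
      then show ?r using R(1,2) Q(3) by blast
    next
      assume ?r
      then obtain R r where R: "finite R" "R \<subseteq> S" "0 < r"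
          "{v \<in> V'. \<forall>s\<in>R. p' s (\<lambda>i. v i - u i) < ennreal r} \<subseteq> U" by blast
      then show ?l by (intro exI[of _ "p' ` R"] exI[of _ r]) auto
    qed
  qed
  have opens: "openin ?Y (\<Phi> ` U) \<longleftrightarrow> openin ?X U" if U: "U \<subseteq> V" for U
  proof -
    have "\<Phi> ` A \<subseteq> \<Phi> ` U \<longleftrightarrow> A \<subseteq> U" if "A \<subseteq> V" for A
      by (rule inj_on_image_subset_iff[OF inj that U])
    then have "{w \<in> W. \<forall>s\<in>R. q s (\<lambda>j. w j - \<Phi> u j) < ennreal r} \<subseteq> \<Phi> ` U \<longleftrightarrow>
        {v \<in> V. \<forall>s\<in>R. p s (\<lambda>i. v i - u i) < ennreal r} \<subseteq> U" if "u \<in> U" "R \<subseteq> S" for u R r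
      using nbhd[OF subsetD[OF U that(1)] that(2)] by simp
    moreover have "\<Phi> ` U \<subseteq> W" using U im by blast
    ultimately show ?thesis unfolding basis using U by (simp add: conj_commute cong: conj_cong)
  qed
  have "homeomorphic_map ?X ?Y \<Phi>"
  proof (rule bijective_open_imp_homeomorphic_map)
    show "open_map ?X ?Y \<Phi>"
      unfolding open_map_def using opens openin_subset[of ?X] by auto
    show "continuous_map ?X ?Y \<Phi>"
      unfolding continuous_map_def
    proof (intro conjI allI impI)
      show "\<Phi> \<in> topspace ?X \<rightarrow> topspace ?Y" using im by auto
      fix U assume U: "openin ?Y U"
      let ?A = "{x \<in> topspace ?X. \<Phi> x \<in> U}"
      have "\<Phi> ` ?A = U" using openin_subset[OF U] im by auto
      then show "openin ?X ?A" using opens[of ?A] U by auto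
    qed
  qed (use im inj in auto)
  then show ?thesis unfolding tvs_isomorphism_def using add scale by simp
qed

section \<open>Continuity of functionals\<close>

lemma rho_le_iff: "rho B f \<le> ennreal s \<longleftrightarrow> (\<forall>x\<in>B. \<bar>f x\<bar> \<le> s)" if "0 \<le> s"
  unfolding rho_def SUP_le_iff using that by (simp add: ennreal_le_iff)

text \<open>A neighborhood of 0 on which \<open>\<bar>F\<bar> < 1\<close> contains some \<open>\<rho>\<^sub>B\<close>-ball of radius \<open>r\<close>, where \<open>B\<close> may be enlarged to a
  closed member of \<open>\<B>\<close>. Scaling \<open>f\<close> into that ball gives the constant \<open>K = 2/r\<close>; it also gives
  \<open>F f = 0\<close> when \<open>f\<close> vanishes on \<open>B\<close>, since then every bound \<open>s > 0\<close> is admissible.\<close>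

lemma continuous_functional_bound:
  assumes bo: "bornology \<B>" and cb: "closed_base \<B>" and F: "F \<in> cdual \<B>"
  obtains B K where "B \<in> \<B>" "closed B"
    "\<And>f s. f \<in> cfun_space \<Longrightarrow> 0 \<le> s \<Longrightarrow> (\<And>x. x \<in> B \<Longrightarrow> \<bar>f x\<bar> \<le> s) \<Longrightarrow> \<bar>F f\<bar> \<le> K * s"
proof -
  have lin: "F (\<lambda>x. c * f x) = c * F f" if "f \<in> cfun_space" for c f
    using F that by (simp add: cdual_def)
  have cont: "continuous_map (tau \<B>) euclidean F" using F by (simp add: cdual_def)
  have z: "(\<lambda>x. 0) \<in> (cfun_space :: ('a \<Rightarrow> real) set)" by (simp add: cfun_space_def)
  have F0: "F (\<lambda>x. 0) = 0" using lin[OF z, of 0] by simp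
  let ?U = "{f \<in> cfun_space. F f \<in> {-1<..<1}}"
  have "openin (tau \<B>) ?U"
    using openin_continuous_map_preimage[OF cont, of "{-1<..<1}"] topspace_tau[OF bo] by simp
  then have "\<exists>T. openin (tau \<B>) T \<and> (\<lambda>x. 0) \<in> T \<and> T \<subseteq> ?U" using z F0 by (intro exI[of _ ?U]) simp
  then obtain B0 r where B0: "B0 \<in> \<B>" "0 < r" "{f \<in> cfun_space. rho B0 f < ennreal r} \<subseteq> ?U"
    unfolding tau_neighborhood_base[OF bo] by blast
  obtain B where B: "B \<in> \<B>" "closed B" "B0 \<subseteq> B" using cb B0(1) unfolding closed_base_def by blast
  have pos: "\<bar>F f\<bar> \<le> 2 / r * s" if f: "f \<in> cfun_space" and s: "0 < s" "\<And>x. x \<in> B \<Longrightarrow> \<bar>f x\<bar> \<le> s" for f s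
  proof -
    let ?g = "\<lambda>x. r / (2 * s) * f x"
    have g: "?g \<in> cfun_space" using f unfolding cfun_space_def mem_Collect_eq by (intro continuous_intros)
    have "rho B0 ?g \<le> ennreal (r / 2)"
    proof (subst rho_le_iff)
      show "\<forall>x\<in>B0. \<bar>?g x\<bar> \<le> r / 2"
      proof
        fix x assume "x \<in> B0"
        then have "r / (2 * s) * \<bar>f x\<bar> \<le> r / (2 * s) * s" using s B(3) B0(2) by (intro mult_left_mono) auto
        then show "\<bar>?g x\<bar> \<le> r / 2" using s(1) B0(2) by (simp add: abs_mult)
      qed
    qed (use B0 in simp)
    also have "\<dots> < ennreal r" using B0(2) by (simp add: ennreal_less_iff)
    finally have "?g \<in> ?U" using B0(3) g by blast
    then have "\<bar>r / (2 * s) * F f\<bar> < 1" using lin[OF f, of "r / (2 * s)"] by auto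
    then show ?thesis using s(1) B0(2) by (simp add: abs_mult field_simps)
  qed
  have "\<bar>F f\<bar> \<le> 2 / r * s" if f: "f \<in> cfun_space" and s: "0 \<le> s" "\<And>x. x \<in> B \<Longrightarrow> \<bar>f x\<bar> \<le> s" for f s
  proof (rule field_le_epsilon)
    fix e :: real assume e: "0 < e"
    have "\<bar>F f\<bar> \<le> 2 / r * (s + e * r / 2)"
    proof (intro pos f)
      have "0 < e * r / 2" using e B0(2) by simp
      then show "0 < s + e * r / 2" using s(1) by simp
      show "\<bar>f x\<bar> \<le> s + e * r / 2" if "x \<in> B" for x
        using s(2)[OF that] \<open>0 < e * r / 2\<close> by linarith
    qed
    also have "\<dots> = 2 / r * s + e" using B0(2) by (simp add: field_simps)
    finally show "\<bar>F f\<bar> \<le> 2 / r * s + e" .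
  qed
  then show ?thesis by (rule that[OF B(1,2)])
qed

lemma continuous_functionalI:
  assumes bo: "bornology \<B>" and B: "B \<in> \<B>"
    and add: "\<And>f g. f \<in> cfun_space \<Longrightarrow> g \<in> cfun_space \<Longrightarrow> F (\<lambda>x. f x + g x) = F f + F g"
    and scale: "\<And>c f. f \<in> cfun_space \<Longrightarrow> F (\<lambda>x. c * f x) = c * F f"
    and out: "\<And>f. f \<notin> cfun_space \<Longrightarrow> F f = 0"
    and bound: "\<And>f s. f \<in> cfun_space \<Longrightarrow> 0 \<le> s \<Longrightarrow> (\<And>x. x \<in> B \<Longrightarrow> \<bar>f x\<bar> \<le> s) \<Longrightarrow> \<bar>F f\<bar> \<le> K * s"
  shows "F \<in> cdual \<B>"
proof -
  have "continuous_map (tau \<B>) euclidean F"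
    unfolding continuous_map_def
  proof (intro conjI allI impI)
    fix U :: "real set" assume "openin euclidean U"
    then have U: "open U" by simp
    let ?A = "{f \<in> topspace (tau \<B>). F f \<in> U}"
    show "openin (tau \<B>) ?A"
      unfolding openin_tau[OF bo]
    proof (intro conjI ballI)
      show "?A \<subseteq> cfun_space" using topspace_tau[OF bo] by auto
      fix u assume "u \<in> ?A"
      then have u: "u \<in> cfun_space" "F u \<in> U" using topspace_tau[OF bo] by auto
      obtain e where e: "0 < e" "ball (F u) e \<subseteq> U" using openE[OF U u(2)] .
      define r where "r = e / (\<bar>K\<bar> + 1)"
      have r: "0 < r" "K * r < e"
      proof -
        show "0 < r" using e(1) by (simp add: r_def add_nonneg_pos)
        have "K * r \<le> \<bar>K\<bar> * r" using \<open>0 < r\<close> by (intro mult_right_mono) auto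
        also have "\<dots> < (\<bar>K\<bar> + 1) * r" using \<open>0 < r\<close> by simp
        also have "\<dots> = e" by (simp add: r_def add_nonneg_pos)
        finally show "K * r < e" .
      qed
      have "F f \<in> U" if f: "f \<in> cfun_space" "rho B (\<lambda>x. f x - u x) < ennreal r" for f
      proof -
        have "\<forall>x\<in>B. \<bar>f x - u x\<bar> \<le> r" using f(2) r(1) by (intro rho_le_iff[THEN iffD1]) auto
        moreover have d: "(\<lambda>x. f x - u x) \<in> cfun_space"
          using f(1) u(1) by (auto simp: cfun_space_def intro: continuous_intros)
        ultimately have "\<bar>F (\<lambda>x. f x - u x)\<bar> \<le> K * r" using r(1) by (intro bound) auto
        moreover have "F f = F (\<lambda>x. f x - u x) + F u" using add[OF d u(1)] by simp
        ultimately show ?thesis using e(2) r(2) by (auto simp: subset_eq dist_real_def)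
      qed
      then show "\<exists>B\<in>\<B>. \<exists>r>0. {f \<in> cfun_space. rho B (\<lambda>x. f x - u x) < ennreal r} \<subseteq> ?A"
        using B r(1) topspace_tau[OF bo] by (intro bexI[of _ B] exI[of _ r]) auto
    qed
  qed simp
  then show ?thesis using assms by (auto simp: cdual_def)
qed

section \<open>Measures as functionals\<close>

definition functional_of :: "('a::metric_space set \<Rightarrow> real) \<Rightarrow> ('a \<Rightarrow> real) \<Rightarrow> real" where
  "functional_of \<mu> f = (if f \<in> cfun_space then signed_integral \<mu> f else 0)"

lemma variation_null:
  assumes mu: "finite_signed_borel \<mu>" and A: "A \<in> sets borel" and "\<And>E. E \<in> sets borel \<Longrightarrow> E \<subseteq> A \<Longrightarrow> \<mu> E = 0"
  shows "emeasure (pos_variation \<mu>) A = 0" "emeasure (neg_variation \<mu>) A = 0"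
proof -
  have "total_variation \<mu> A = 0" using total_variation_eq_0_iff[OF mu A] assms(3) by blast
  then show "emeasure (pos_variation \<mu>) A = 0" "emeasure (neg_variation \<mu>) A = 0"
    by (auto simp: total_variation_def)
qed

lemma closed_member_compact:
  assumes "\<B> \<subseteq> relatively_compact_bornology" "B \<in> \<B>" "closed B"
  shows "compact B" "B \<noteq> {}"
  using assms by (auto simp: relatively_compact_bornology_def closure_closed)

lemma measure_space_onD:
  fixes \<B> :: "'a::metric_space set set"
  assumes rc: "\<B> \<subseteq> relatively_compact_bornology" and mu: "\<mu> \<in> measure_space_on \<B>"
  obtains B where "B \<in> \<B>" "closed B" "compact B" "\<And>E. E \<in> sets borel \<Longrightarrow> E \<inter> B = {} \<Longrightarrow> \<mu> E = 0"
    "emeasure (pos_variation \<mu>) (UNIV - B) = 0" "emeasure (neg_variation \<mu>) (UNIV - B) = 0"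
proof -
  obtain B where B: "B \<in> \<B>" "closed B" "\<And>E. E \<in> sets borel \<Longrightarrow> E \<inter> B = {} \<Longrightarrow> \<mu> E = 0" and fs: "finite_signed_borel \<mu>"
    using mu unfolding measure_space_on_iff by blast
  have "UNIV - B \<in> sets borel" using B(2) by auto
  moreover have "\<mu> E = 0" if "E \<in> sets borel" "E \<subseteq> UNIV - B" for E using B(3) that by blast
  ultimately show ?thesis using that[OF B(1,2) _ B(3)] closed_member_compact(1)[OF rc B(1,2)] variation_null[OF fs] by blast
qed

lemma measure_space_on_finite: "\<mu> \<in> measure_space_on \<B> \<Longrightarrow> finite_signed_borel \<mu>"
  by (simp add: measure_space_on_def)

lemma measure_space_on_integrable:
  fixes \<B> :: "'a::metric_space set set" and f :: "'a \<Rightarrow> real"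
  assumes rc: "\<B> \<subseteq> relatively_compact_bornology" and mu: "\<mu> \<in> measure_space_on \<B>" and f: "continuous_on UNIV f"
  shows "integrable (pos_variation \<mu>) f" "integrable (neg_variation \<mu>) f"
proof -
  note fs = measure_space_on_finite[OF mu]
  obtain B where B: "compact B"
    "emeasure (pos_variation \<mu>) (UNIV - B) = 0" "emeasure (neg_variation \<mu>) (UNIV - B) = 0"
    using measure_space_onD[OF rc mu] by metis
  show "integrable (pos_variation \<mu>) f" "integrable (neg_variation \<mu>) f"
    using integrable_of_compact_support[OF finite_measure_pos_variation[OF fs] sets_pos_variation B(1,2) f]
      integrable_of_compact_support[OF finite_measure_neg_variation[OF fs] sets_neg_variation B(1,3) f] .
qed

lemma measure_space_on_add:
  fixes \<B> :: "'a::metric_space set set"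
  assumes bo: "bornology \<B>" and mu: "\<mu> \<in> measure_space_on \<B>" and nu: "\<nu> \<in> measure_space_on \<B>"
  shows "(\<lambda>A. \<mu> A + \<nu> A) \<in> measure_space_on \<B>"
proof -
  obtain B where B: "B \<in> \<B>" "closed B" "\<forall>E\<in>sets borel. E \<inter> B = {} \<longrightarrow> \<mu> E = 0"
    using mu unfolding measure_space_on_iff by blast
  obtain C where C: "C \<in> \<B>" "closed C" "\<forall>E\<in>sets borel. E \<inter> C = {} \<longrightarrow> \<nu> E = 0"
    using nu unfolding measure_space_on_iff by blast
  have "finite_signed_borel (\<lambda>A. \<mu> A + \<nu> A)"
    using measure_space_on_finite[OF mu] measure_space_on_finite[OF nu]
    unfolding finite_signed_borel_def by (simp add: sums_add)
  moreover have "\<forall>E\<in>sets borel. E \<inter> (B \<union> C) = {} \<longrightarrow> \<mu> E + \<nu> E = 0"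
    using B(3) C(3) by (simp add: Int_Un_distrib)
  ultimately show ?thesis
    unfolding measure_space_on_iff using bornology_Un[OF bo B(1) C(1)] closed_Un[OF B(2) C(2)] by blast
qed

lemma measure_space_on_scale:
  fixes \<B> :: "'a::metric_space set set"
  assumes mu: "\<mu> \<in> measure_space_on \<B>"
  shows "(\<lambda>A. c * \<mu> A) \<in> measure_space_on \<B>"
proof -
  have "finite_signed_borel (\<lambda>A. c * \<mu> A)"
    using measure_space_on_finite[OF mu] unfolding finite_signed_borel_def by (auto intro: sums_mult)
  then show ?thesis using mu unfolding measure_space_on_iff by fastforce
qed

lemma functional_of_add:
  fixes \<B> :: "'a::metric_space set set"
  assumes bo: "bornology \<B>" and rc: "\<B> \<subseteq> relatively_compact_bornology"
    and mu: "\<mu> \<in> measure_space_on \<B>" and nu: "\<nu> \<in> measure_space_on \<B>"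
  shows "functional_of (\<lambda>A. \<mu> A + \<nu> A) = (\<lambda>f. functional_of \<mu> f + functional_of \<nu> f)"
proof
  fix f :: "'a \<Rightarrow> real"
  note sum = measure_space_on_add[OF bo mu nu]
  show "functional_of (\<lambda>A. \<mu> A + \<nu> A) f = functional_of \<mu> f + functional_of \<nu> f"
  proof (cases "f \<in> cfun_space")
    case True
    then have f: "continuous_on UNIV f" by (simp add: cfun_space_def)
    have "signed_integral (\<lambda>A. \<mu> A + \<nu> A) f = signed_integral \<mu> f + signed_integral \<nu> f"
      by (intro signed_integral_add measure_space_on_finite[OF mu] measure_space_on_finite[OF nu] measure_space_on_finite[OF sum]
          measure_space_on_integrable[OF rc mu f] measure_space_on_integrable[OF rc nu f]
          measure_space_on_integrable[OF rc sum f] borel_measurable_continuous_onI f)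
    then show ?thesis using True by (simp add: functional_of_def)
  qed (simp add: functional_of_def)
qed

lemma functional_of_scale:
  fixes \<B> :: "'a::metric_space set set"
  assumes rc: "\<B> \<subseteq> relatively_compact_bornology" and mu: "\<mu> \<in> measure_space_on \<B>"
  shows "functional_of (\<lambda>A. c * \<mu> A) = (\<lambda>f. c * functional_of \<mu> f)"
proof
  fix f :: "'a \<Rightarrow> real"
  note cmu = measure_space_on_scale[OF mu, of c]
  show "functional_of (\<lambda>A. c * \<mu> A) f = c * functional_of \<mu> f"
  proof (cases "f \<in> cfun_space")
    case True
    then have f: "continuous_on UNIV f" by (simp add: cfun_space_def)
    have "signed_integral (\<lambda>A. c * \<mu> A) f = c * signed_integral \<mu> f"
      by (intro signed_integral_scale measure_space_on_finite[OF mu] measure_space_on_finite[OF cmu]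
          measure_space_on_integrable[OF rc mu f] measure_space_on_integrable[OF rc cmu f] borel_measurable_continuous_onI f)
    then show ?thesis using True by (simp add: functional_of_def)
  qed (simp add: functional_of_def)
qed

lemma integral_le_support:
  fixes f :: "'a::metric_space \<Rightarrow> real"
  assumes M: "finite_measure M" "sets M = sets borel" and B: "compact B" "emeasure M (UNIV - B) = 0"
    and f: "continuous_on UNIV f" and s: "\<And>x. x \<in> B \<Longrightarrow> \<bar>f x\<bar> \<le> s"
  shows "\<bar>integral\<^sup>L M f\<bar> \<le> measure M UNIV * s"
proof -
  interpret finite_measure M by fact
  have sp: "space M = UNIV" using sets_eq_imp_space_eq[OF M(2)] by simp
  have int: "integrable M (\<lambda>x. \<bar>f x\<bar>)" by (intro integrable_of_compact_support[OF M B] continuous_intros f)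
  have "\<bar>integral\<^sup>L M f\<bar> \<le> integral\<^sup>L M (\<lambda>x. \<bar>f x\<bar>)" by (rule integral_abs_bound)
  also have "\<dots> \<le> integral\<^sup>L M (\<lambda>x. s)"
  proof (rule integral_mono_AE[OF int])
    show "AE x in M. \<bar>f x\<bar> \<le> s" using AE_in_compact_support[OF M(2) B] by eventually_elim (use s in auto)
  qed simp
  also have "\<dots> = measure M UNIV * s" by (simp add: sp)
  finally show ?thesis .
qed

lemma functional_of_in_cdual:
  fixes \<B> :: "'a::metric_space set set"
  assumes bo: "bornology \<B>" and rc: "\<B> \<subseteq> relatively_compact_bornology" and mu: "\<mu> \<in> measure_space_on \<B>"
  shows "functional_of \<mu> \<in> cdual \<B>"
proof -
  note fs = measure_space_on_finite[OF mu]
  let ?P = "pos_variation \<mu>" and ?N = "neg_variation \<mu>"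
  note fin = finite_measure_pos_variation[OF fs] finite_measure_neg_variation[OF fs]
  obtain B where B: "B \<in> \<B>" "compact B" "emeasure ?P (UNIV - B) = 0" "emeasure ?N (UNIV - B) = 0"
    using measure_space_onD[OF rc mu] by metis
  note int = measure_space_on_integrable[OF rc mu]
  have c: "f \<in> cfun_space \<longleftrightarrow> continuous_on UNIV f" for f :: "'a \<Rightarrow> real" by (simp add: cfun_space_def)
  show ?thesis
  proof (rule continuous_functionalI[OF bo B(1), where K = "measure ?P UNIV + measure ?N UNIV"])
    fix f g :: "'a \<Rightarrow> real" assume f: "f \<in> cfun_space"
    note f' = f[unfolded c]
    show "functional_of \<mu> (\<lambda>x. a * f x) = a * functional_of \<mu> f" for a
      using f' int[OF f'] by (simp add: functional_of_def signed_integral_def c right_diff_distrib continuous_intros)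
    show "\<bar>functional_of \<mu> f\<bar> \<le> (measure ?P UNIV + measure ?N UNIV) * s"
      if s: "0 \<le> s" "\<And>x. x \<in> B \<Longrightarrow> \<bar>f x\<bar> \<le> s" for s
      using integral_le_support[OF fin(1) sets_pos_variation B(2,3) f' s(2)]
        integral_le_support[OF fin(2) sets_neg_variation B(2,4) f' s(2)] f
      by (simp add: functional_of_def signed_integral_def distrib_right)
    assume g: "g \<in> cfun_space"
    note g' = g[unfolded c]
    show "functional_of \<mu> (\<lambda>x. f x + g x) = functional_of \<mu> f + functional_of \<mu> g"
      using f' g' int[OF f'] int[OF g'] by (simp add: functional_of_def signed_integral_def c continuous_intros)
  qed (simp add: functional_of_def)
qed

section \<open>Measures are determined by their functionals\<close>

text \<open>The functions \<open>max 0 (1 - n \<cdot> infdist x C)\<close> decrease to the indicator of a closed set \<open>C\<close>, and the closed sets are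
  an intersection-stable generator of the Borel sets.\<close>

lemma finite_borel_measure_eqI:
  fixes M N :: "'a::metric_space measure"
  assumes M: "finite_measure M" "sets M = sets borel" and N: "finite_measure N" "sets N = sets borel"
    and eq: "\<And>f :: 'a \<Rightarrow> real. continuous_on UNIV f \<Longrightarrow> (\<And>x. 0 \<le> f x) \<Longrightarrow> (\<And>x. f x \<le> 1) \<Longrightarrow> integral\<^sup>L M f = integral\<^sup>L N f"
  shows "M = N"
proof (rule measure_eqI_generator_eq[where E = "Collect closed" and \<Omega> = UNIV and A = "\<lambda>_. UNIV"])
  interpret M: finite_measure M by fact
  interpret N: finite_measure N by fact
  show "Int_stable (Collect closed :: 'a set set)" by (auto simp: Int_stable_def)
  show "sets M = sigma_sets UNIV (Collect closed)" "sets N = sigma_sets UNIV (Collect closed)"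
    using M(2) N(2) unfolding borel_eq_closed by auto
  show "emeasure M UNIV \<noteq> \<infinity>" by simp
  fix C :: "'a set" assume "C \<in> Collect closed"
  then have C: "closed C" by simp
  show "emeasure M C = emeasure N C"
  proof (cases "C = {}")
    case False
    define f where "f n x = max 0 (1 - real n * infdist x C)" for n x
    have f: "continuous_on UNIV (f n)" "0 \<le> f n x" "f n x \<le> 1" for n x
      unfolding f_def by (auto intro!: continuous_intros infdist_nonneg mult_nonneg_nonneg)
    have lim: "(\<lambda>n. f n x) \<longlonglongrightarrow> indicator C x" for x
    proof (cases "x \<in> C")
      case True
      then show ?thesis by (simp add: f_def)
    next
      case nx: False
      then have "0 < infdist x C"
        using in_closed_iff_infdist_zero[OF C False, of x] infdist_nonneg[of x C] by auto
      obtain k where k: "1 / infdist x C \<le> real k" using real_arch_simple by blast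
      have "f n x = 0" if "k \<le> n" for n
      proof -
        have "1 / infdist x C \<le> real n" using k that by simp
        then show ?thesis using \<open>0 < infdist x C\<close> by (simp add: f_def field_simps)
      qed
      then have "eventually (\<lambda>n. f n x = indicator C x) sequentially"
        using nx by (auto simp: eventually_sequentially)
      then show ?thesis by (rule tendsto_eventually)
    qed
    have conv: "(\<lambda>n. integral\<^sup>L L (f n)) \<longlonglongrightarrow> measure L C"
      if L: "finite_measure L" "sets L = sets borel" for L
    proof -
      interpret finite_measure L by fact
      have "(\<lambda>n. integral\<^sup>L L (f n)) \<longlonglongrightarrow> integral\<^sup>L L (indicator C)"
      proof (rule integral_dominated_convergence[where w = "\<lambda>_. 1"])
        show "indicator C \<in> borel_measurable L" using C L(2) by (intro borel_measurable_indicator) auto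
        show "f n \<in> borel_measurable L" for n
          using borel_measurable_continuous_onI[OF f(1)] measurable_cong_sets[OF L(2) refl] by blast
      qed (use f lim in auto)
      moreover have "space L = UNIV" using sets_eq_imp_space_eq[OF L(2)] by simp
      ultimately show ?thesis by simp
    qed
    have "integral\<^sup>L M (f n) = integral\<^sup>L N (f n)" for n by (intro eq f)
    then have "measure M C = measure N C"
      using LIMSEQ_unique[OF conv[OF M]] conv[OF N] by simp
    then show ?thesis by (simp add: M.emeasure_eq_measure N.emeasure_eq_measure)
  qed simp
qed auto

lemma functional_of_eq_0:
  fixes \<mu> :: "'a::metric_space set \<Rightarrow> real"
  assumes mu: "finite_signed_borel \<mu>" and zero: "functional_of \<mu> = (\<lambda>f. 0)"
  shows "\<mu> = (\<lambda>A. 0)"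
proof -
  have "pos_variation \<mu> = neg_variation \<mu>"
  proof (rule finite_borel_measure_eqI)
    fix f :: "'a \<Rightarrow> real" assume "continuous_on UNIV f"
    then have "signed_integral \<mu> f = functional_of \<mu> f" by (simp add: functional_of_def cfun_space_def)
    then show "integral\<^sup>L (pos_variation \<mu>) f = integral\<^sup>L (neg_variation \<mu>) f"
      by (simp add: zero signed_integral_def)
  qed (simp_all add: finite_measure_pos_variation[OF mu] finite_measure_neg_variation[OF mu])
  then have "\<mu> A = 0" if "A \<in> sets borel" for A
    using measure_pos_variation_minus[OF mu that] by simp
  moreover have "\<mu> A = 0" if "A \<notin> sets borel" for A
    using mu that by (simp add: finite_signed_borel_def)
  ultimately show ?thesis by blast
qed

lemma functional_of_inj:
  fixes \<B> :: "'a::metric_space set set"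
  assumes bo: "bornology \<B>" and rc: "\<B> \<subseteq> relatively_compact_bornology"
  shows "inj_on functional_of (measure_space_on \<B>)"
proof (rule inj_onI)
  fix \<mu> \<nu> assume mu: "\<mu> \<in> measure_space_on \<B>" and nu: "\<nu> \<in> measure_space_on \<B>"
    and eq: "functional_of \<mu> = functional_of \<nu>"
  note nu' = measure_space_on_scale[OF nu, of "-1"]
  have "functional_of (\<lambda>A. \<mu> A + - 1 * \<nu> A) = (\<lambda>f. 0)"
    unfolding functional_of_add[OF bo rc mu nu'] functional_of_scale[OF rc nu] eq by simp
  then have "(\<lambda>A. \<mu> A + - 1 * \<nu> A) = (\<lambda>A. 0)"
    using measure_space_on_finite[OF measure_space_on_add[OF bo mu nu']] by (intro functional_of_eq_0)
  then show "\<mu> = \<nu>" by (auto simp: fun_eq_iff)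
qed

section \<open>Surjectivity and the isomorphism\<close>

lemma functional_of_surj:
  fixes \<B> :: "'a::metric_space set set"
  assumes bo: "bornology \<B>" and cb: "closed_base \<B>" and rc: "\<B> \<subseteq> relatively_compact_bornology"
    and F: "F \<in> cdual \<B>"
  shows "\<exists>\<mu>\<in>measure_space_on \<B>. functional_of \<mu> = F"
proof -
  have c: "f \<in> cfun_space \<longleftrightarrow> continuous_on UNIV f" for f :: "'a \<Rightarrow> real" by (simp add: cfun_space_def)
  obtain B K where B: "B \<in> \<B>" "closed B" and
    bound: "\<And>f s. f \<in> cfun_space \<Longrightarrow> 0 \<le> s \<Longrightarrow> (\<And>x. x \<in> B \<Longrightarrow> \<bar>f x\<bar> \<le> s) \<Longrightarrow> \<bar>F f\<bar> \<le> K * s"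
    using continuous_functional_bound[OF bo cb F] by metis
  note Bc = closed_member_compact[OF rc B] and B_member = B(1) and B_closed = B(2)
  interpret bounded_functional F B K
    using F Bc bound by unfold_locales (auto simp: cdual_def c)
  obtain M N where M: "finite_measure M" "sets M = sets borel" "emeasure M (UNIV - B) = 0"
    and N: "finite_measure N" "sets N = sets borel" "emeasure N (UNIV - B) = 0"
    and rep: "\<And>f. continuous_on UNIV f \<Longrightarrow> F f = integral\<^sup>L M f - integral\<^sup>L N f"
    using representation by metis
  interpret M: finite_measure M by fact
  interpret N: finite_measure N by fact
  define \<mu> where "\<mu> A = measure M A - measure N A" for A
  have fs: "finite_signed_borel \<mu>"
    unfolding finite_signed_borel_def
  proof (intro conjI allI impI)
    fix A :: "nat \<Rightarrow> 'a set" assume A: "range A \<subseteq> sets borel \<and> disjoint_family A"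
    then show "(\<lambda>n. \<mu> (A n)) sums \<mu> (\<Union>n. A n)"
      unfolding \<mu>_def using M(2) N(2)
      by (intro sums_diff M.finite_measure_UNION N.finite_measure_UNION) auto
  next
    fix A :: "'a set" assume "A \<notin> sets borel"
    then show "\<mu> A = 0" using M(2) N(2) by (simp add: \<mu>_def measure_notin_sets)
  qed (simp add: \<mu>_def)
  have "\<mu> E = 0" if E: "E \<in> sets borel" "E \<inter> B = {}" for E
  proof -
    have "UNIV - B \<in> sets borel" "E \<subseteq> UNIV - B" using B_closed E by (auto simp: open_Diff)
    then have "emeasure M E \<le> emeasure M (UNIV - B)" "emeasure N E \<le> emeasure N (UNIV - B)"
      using M(2) N(2) by (auto intro!: emeasure_mono)
    then show ?thesis using M(3) N(3) by (simp add: \<mu>_def measure_def)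
  qed
  then have mu: "\<mu> \<in> measure_space_on \<B>" unfolding measure_space_on_iff using fs B_member B_closed by blast
  have "functional_of \<mu> f = F f" for f
  proof (cases "f \<in> cfun_space")
    case True
    then have f: "continuous_on UNIV f" by (simp add: c)
    have "signed_integral \<mu> f = integral\<^sup>L M f - integral\<^sup>L N f"
      by (intro signed_integral_difference fs M(1,2) N(1,2) borel_measurable_continuous_onI f
          integrable_of_compact_support[OF M(1,2) Bc(1) M(3) f] integrable_of_compact_support[OF N(1,2) Bc(1) N(3) f]
          measure_space_on_integrable[OF rc mu f]) (simp add: \<mu>_def)
    then show ?thesis using True rep[OF f] by (simp add: functional_of_def)
  next
    case False
    then show ?thesis using F by (simp add: functional_of_def cdual_def)
  qed
  then show ?thesis using mu by blast
qed

theorem theorem4p12: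
  fixes \<B> :: "'a::metric_space set set"
  assumes "bornology \<B>"
    and "closed_base \<B>"
    and "\<B> \<subseteq> relatively_compact_bornology"
  shows "tvs_isomorphic (tau_ucb \<B>) (sigma_topology \<B>)"
proof -
  note bo = assms(1) and cb = assms(2) and rc = assms(3)
  let ?V = "cdual \<B>" and ?W = "measure_space_on \<B>"
  have bij: "bij_betw functional_of ?W ?V"
    unfolding bij_betw_def
  proof
    show "functional_of ` ?W = ?V"
    proof (intro set_eqI iffI)
      fix F assume "F \<in> ?V"
      then show "F \<in> functional_of ` ?W" using functional_of_surj[OF bo cb rc] by blast
    qed (use functional_of_in_cdual[OF bo rc] in blast)
  qed (rule functional_of_inj[OF bo rc])
  define \<Phi> where "\<Phi> = inv_into ?W functional_of"
  have Phi: "bij_betw \<Phi> ?V ?W" unfolding \<Phi>_def by (rule bij_betw_inv_into[OF bij])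
  have in_W: "\<Phi> F \<in> ?W" if "F \<in> ?V" for F using bij_betwE[OF Phi] that by blast
  have right: "functional_of (\<Phi> F) = F" if "F \<in> ?V" for F
    unfolding \<Phi>_def using bij that by (simp add: bij_betw_inv_into_right)
  have left: "\<Phi> (functional_of \<mu>) = \<mu>" if "\<mu> \<in> ?W" for \<mu>
    unfolding \<Phi>_def using bij that by (simp add: bij_betw_inv_into_left)
  have add_fun: "functional_of (\<lambda>A. \<Phi> F A + \<Phi> G A) = (\<lambda>f. F f + G f)" if "F \<in> ?V" "G \<in> ?V" for F G
    using functional_of_add[OF bo rc in_W[OF that(1)] in_W[OF that(2)]] right that by simp
  have scale_fun: "functional_of (\<lambda>A. c * \<Phi> F A) = (\<lambda>f. c * F f)" if "F \<in> ?V" for c F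
    using functional_of_scale[OF rc in_W[OF that]] right that by simp
  have add: "\<Phi> (\<lambda>f. F f + G f) = (\<lambda>A. \<Phi> F A + \<Phi> G A)" if "F \<in> ?V" "G \<in> ?V" for F G
    using left[OF measure_space_on_add[OF bo in_W[OF that(1)] in_W[OF that(2)]]] add_fun[OF that] by simp
  have scale: "\<Phi> (\<lambda>f. c * F f) = (\<lambda>A. c * \<Phi> F A)" if "F \<in> ?V" for c F
    using left[OF measure_space_on_scale[OF in_W[OF that]]] scale_fun[OF that] by simp
  have smult: "(\<lambda>f. c * F f) \<in> ?V" if "F \<in> ?V" for c F
    using functional_of_in_cdual[OF bo rc measure_space_on_scale[OF in_W[OF that], of c]] scale_fun[OF that] by simp
  have plus: "(\<lambda>f. F f + G f) \<in> ?V" if "F \<in> ?V" "G \<in> ?V" for F G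
    using functional_of_in_cdual[OF bo rc measure_space_on_add[OF bo in_W[OF that(1)] in_W[OF that(2)]]]
      add_fun[OF that] by simp
  have diff: "(\<lambda>f. F f - G f) \<in> ?V" if "F \<in> ?V" "G \<in> ?V" for F G
    using plus[OF that(1) smult[OF that(2), of "-1"]] by simp
  let ?S = "{\<F>. vbounded (tau \<B>) \<F>}"
  have "signed_integral (\<Phi> F) f = F f" if "F \<in> ?V" "vbounded (tau \<B>) \<F>" "f \<in> \<F>" for F \<F> f
  proof -
    have "f \<in> cfun_space" using that(2,3) topspace_tau[OF bo] by (auto simp: vbounded_def)
    then show ?thesis using fun_cong[OF right[OF that(1)], of f] by (simp add: functional_of_def)
  qed
  then have semi: "(SUP f\<in>\<F>. ennreal \<bar>signed_integral (\<Phi> F) f\<bar>) = (SUP f\<in>\<F>. ennreal \<bar>F f\<bar>)"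
    if "\<F> \<in> ?S" "F \<in> ?V" for \<F> F using that by (intro SUP_cong) auto
  have "tvs_isomorphism (seminorm_topology ?V ((\<lambda>\<F> F. SUP f\<in>\<F>. ennreal \<bar>F f\<bar>) ` ?S))
     (seminorm_topology ?W ((\<lambda>\<F> \<mu>. SUP f\<in>\<F>. ennreal \<bar>signed_integral \<mu> f\<bar>) ` ?S)) \<Phi>"
  proof (rule tvs_isomorphism_of_seminorms[OF Phi])
    fix \<F> F assume "\<F> \<in> ?S" "F \<in> ?V"
    then show "(SUP f\<in>\<F>. ennreal \<bar>signed_integral (\<Phi> F) f\<bar>) = (SUP f\<in>\<F>. ennreal \<bar>F f\<bar>)"
      by (rule semi)
  qed (fact add scale diff smult)+
  then have "tvs_isomorphism (tau_ucb \<B>) (sigma_topology \<B>) \<Phi>"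
    unfolding tau_ucb_def sigma_topology_def setcompr_eq_image .
  then show ?thesis unfolding tvs_isomorphic_def by blast
qed

end
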